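(* Consider the factor model with missing factor, pricing errors and risk premia $\boldsymbol\lambda_0$ described in the context, and suppose Assumptions 1, 2, 3, 4 and 5 of the context hold, that all observed factors are strong ($\alpha_k=1$ for $k=1,\dots,K$), and that $\alpha_\gamma<1/2$. Let $\hat{\boldsymbol\lambda}_{nT}$ be the Fama–MacBeth two-pass estimator of $\boldsymbol\lambda_0$, $$\hat{\boldsymbol\lambda}_{nT}=(\hat{\mathbf B}_{nT}'\mathbf M_n\hat{\mathbf B}_{nT})^{-1}\hat{\mathbf B}_{nT}'\mathbf M_n\bar{\mathbf r}_{n\circ}.$$ Then for any fixed $T>T_0$ such that $\lambda_{\min}(T^{-1}\mathbf F'\mathbf M_T\mathbf F)>0$, as $n\to\infty$, $$\hat{\boldsymbol\lambda}_{nT}-\boldsymbol\lambda_0=(\hat{\boldsymbol\mu}_T-\boldsymbol\mu_0)-\frac{\bar\sigma^2}{T}\left[\boldsymbol\Sigma_{\beta\beta}+\frac{\bar\sigma^2}{T}\left(\frac{\mathbf F'\mathbf M_T\mathbf F}{T}\right)^{-1}\right]^{-1}\left(\frac{\mathbf F'\mathbf M_T\mathbf F}{T}\right)^{-1}\boldsymbol\lambda_T^{*}+o_p(1),$$ where $\hat{\boldsymbol\mu}_T=T^{-1}\sum_{t=1}^T\mathbf f_t$, $\boldsymbol\lambda_T^*=\boldsymbol\lambda_0+(\hat{\boldsymbol\mu}_T-\boldsymbol\mu_0)$, $\boldsymbol\Sigma_{\beta\beta}=\lim_{n\to\infty}n^{-1}\mathbf B_n'\mathbf M_n\mathbf B_n$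 and $\bar\sigma^2=\lim_{n\to\infty}n^{-1}\sum_{i=1}^n\sigma_i^2>0$ (these limits being assumed to exist, in probability where the loadings are random).
   Context: Setting. $K$ is a fixed integer. For $i=1,\dots,n$, $t=1,\dots,T$ the excess returns satisfy $r_{it}=a_i+\boldsymbol\beta_i'\mathbf f_t+u_{it}$, $u_{it}=\gamma_ig_t+v_{it}$, where $\mathbf f_t=(f_{1t},\dots,f_{Kt})'$ are observed factors with true mean $\boldsymbol\mu_0$, $\boldsymbol\beta_i=(\beta_{i1},\dots,\beta_{iK})'$, and $g_t$ is a scalar missing (latent) factor. Risk premia: $E(r_{it})=c+\boldsymbol\beta_i'\boldsymbol\lambda_0+\eta_i$, i.e. $a_i=c+\boldsymbol\beta_i'\boldsymbol\phi_0+\eta_i$ with $\boldsymbol\phi_0=\boldsymbol\lambda_0-\boldsymbol\mu_0$; $c$ is a scalar and $\eta_i$ is a pricing error. Notation. $\boldsymbol\tau_m$ is the $m$-vector of ones, $\mathbf M_m=\mathbf I_m-m^{-1}\boldsymbol\tau_m\boldsymbol\tau_m'$; $\mathbf F=(\mathbf f_1,\dots,\mathbf f_T)'$; $\mathbf B_n=(\boldsymbol\beta_1,\dots,\boldsymbol\beta_n)'$; $\bar\beta_k=n^{-1}\sum_i\beta_{ik}$; $\mathbf r_{i\circ}=(r_{i1},\dots,r_{iT})'$; $\bar{\mathbf r}_{n\circ}=(\bar r_{1\circ},\dots,\bar r_{n\circ})'$, $\bar r_{i\circ}=T^{-1}\sum_tr_{it}$; $\hat{\boldsymbol\beta}_{iT}=(\mathbf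 F'\mathbf M_T\mathbf F)^{-1}\mathbf F'\mathbf M_T\mathbf r_{i\circ}$, $\hat{\mathbf B}_{nT}=(\hat{\boldsymbol\beta}_{1T},\dots,\hat{\boldsymbol\beta}_{nT})'$; $\sigma_i^2=E(u_{it}^2)$. $C$ and $c$ in bounds denote generic positive finite constants. $f_n=\ominus(g_n)$ ($\ominus_p$ for the in-probability version) means $f_n$ and $g_n$ are of exactly the same order. Assumption 1 (observed factors). (a) $\mathbf f_t=\boldsymbol\mu+\sum_{\ell\ge0}\boldsymbol\Psi_\ell\boldsymbol\zeta_{t-\ell}$, $\|\boldsymbol\mu\|<C$, $\boldsymbol\zeta_t\sim IID(\mathbf 0,\mathbf I_K)$, $\|\boldsymbol\Psi_\ell\|<C\rho^\ell$ for some $C>0$, $0<\rho<1$. (b) $\mathbf F$ has full column rank and there is $T_0$ such that for all $T>T_0$, $\hat{\boldsymbol\Sigma}_f=T^{-1}\mathbf F'\mathbf M_T\mathbf F$ is positive definite, $\lambda_{\max}(\hat{\boldsymbol\Sigma}_f^{-1})<C$, and $\hat{\boldsymbol\Sigma}_f\to_p\boldsymbol\Sigma_f=E[(\mathbf f_t-\boldsymbol\mu_0)(\mathbf f_t-\boldsymbol\mu_0)']$, which is positive definite. Assumption 2 (loadings). (a) $\sup_{i,k}E(\beta_{ik}^2)<C$ and $\sum_{i=1}^n(\beta_{ik}-\bar\beta_k)^2=\ominus_p(n^{\alpha_k})$, $k=1,\dots,K$; $\alpha_k\in(0,1]$ is the strength of factor $k$. (b) $0<c<\lambda_{\min}(\mathbf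 D_\alpha^{-1}\mathbf B_n'\mathbf M_n\mathbf B_n\mathbf D_\alpha^{-1})<\lambda_{\max}(\mathbf D_\alpha^{-1}\mathbf B_n'\mathbf M_n\mathbf B_n\mathbf D_\alpha^{-1})<C<\infty$ with $\mathbf D_\alpha=Diag(n^{\alpha_1/2},\dots,n^{\alpha_K/2})$. Assumption 3 (latent factor). (a) $g_t$ is independent of $\mathbf f_{t'}$ for all $t,t'$, serially independent, $E(g_t)=0$, $E(g_t^2)=1$, $\sup_tE(g_t^4)<C$. (b) $\sup_i|\gamma_i|<C$ and $\sum_{i=1}^n|\gamma_i|=O(n^{\alpha_\gamma})$. Assumption 4 (idiosyncratic errors). (a) The $v_{it}$ are independent of all $f_{kt'}$, $g_{t'}$ and of the loadings $\beta_{ik},\gamma_i$; they are serially independent with $E(v_{it})=0$, $E(v_{it}^4)<\infty$, $E(v_{it}v_{jt})=\sigma_{v,ij}$, $\sup_i\sum_{j=1}^n|\sigma_{v,ij}|<\infty$, $\sup_i\sum_{j=1}^nCov(v_{it}^2,v_{jt}^2)<\infty$, and $\lambda_{\min}(\mathbf V_v)>0$ with $\mathbf V_v=(\sigma_{v,ij})$. (b) For $k=1,\dots,K$ (here with $\alpha_k=1$), $T^{-1/2}n^{-1/2}\sum_{t=1}^T\sum_{i=1}^n(\beta_{ik}-\bar\beta_k)v_{it}\to_dN(0,\omega_k^2)$, $\omega_k^2=\operatorname{plim}_{n\to\infty}n^{-1}\sum_{i,j=1}^n(\beta_{ik}-\bar\beta_k)(\beta_{jk}-\bar\beta_k)\sigma_{v,ij}$.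 Assumption 5 (pricing errors). $\sup_j|\eta_j|<C$, the $\eta_i$ are independent of all $\beta_{jk}$ and $\gamma_j$, and $\sum_{i=1}^n|\eta_i|=O(n^{\alpha_\eta})$ with $\alpha_\eta<1/2$. *)

theory Defs
  imports "HOL-Probability.Probability"
begin

section \<open>Data matrices with a varying number of rows\<close>

text \<open>
  An \<open>m \<times> K\<close> data matrix (such as \<open>F\<close>, \<open>B\<^sub>n\<close> and its estimate) is represented by its sequence of rows
  \<open>X s :: real ^ 'k\<close>, of which the first \<open>m\<close> are used; an \<open>m\<close>-vector is a function on \<open>{..<m}\<close>.
  Units and periods are thus numbered from 0: \<open>i < n\<close> and \<open>t < T\<close> stand for \<open>i = 1,\<dots>,n\<close> and
  \<open>t = 1,\<dots>,T\<close>.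
\<close>

text \<open>Entries of \<open>M\<^sub>m = I\<^sub>m - m\<^sup>-\<^sup>1 \<tau>\<^sub>m \<tau>\<^sub>m'\<close>.\<close>

definition cmat :: "nat \<Rightarrow> nat \<Rightarrow> nat \<Rightarrow> real" where
  "cmat m s t = (if s = t then 1 else 0) - 1 / real m"

text \<open>\<open>X' M\<^sub>m X\<close> and \<open>X' M\<^sub>m y\<close>.\<close>

definition gram :: "nat \<Rightarrow> (nat \<Rightarrow> real ^ 'k) \<Rightarrow> real ^ 'k ^ 'k" where
  "gram m X = (\<chi> k l. \<Sum>s<m. \<Sum>t<m. X s $ k * cmat m s t * X t $ l)"

definition cross :: "nat \<Rightarrow> (nat \<Rightarrow> real ^ 'k) \<Rightarrow> (nat \<Rightarrow> real) \<Rightarrow> real ^ 'k" where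
  "cross m X y = (\<chi> k. \<Sum>s<m. \<Sum>t<m. X s $ k * cmat m s t * y t)"

definition avg :: "nat \<Rightarrow> (nat \<Rightarrow> 'a) \<Rightarrow> 'a::real_vector" where
  "avg m x = (1 / real m) *\<^sub>R (\<Sum>s<m. x s)"

text \<open>As for the library's \<open>rank\<close>, the rank is the dimension of the row space.\<close>

definition full_column_rank :: "nat \<Rightarrow> (nat \<Rightarrow> real ^ 'k) \<Rightarrow> bool" where
  "full_column_rank m X \<longleftrightarrow> dim (X ` {..<m}) = CARD('k)"

section \<open>Eigenvalues\<close>

text \<open>The extreme eigenvalues are used for symmetric matrices only.\<close>

definition eigenvalues :: "real ^ 'k ^ 'k \<Rightarrow> real set" where
  "eigenvalues A = {e. \<exists>x. x \<noteq> 0 \<and> A *v x = e *s x}"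

definition lambda_min :: "real ^ 'k ^ 'k \<Rightarrow> real" where
  "lambda_min A = Min (eigenvalues A)"

definition lambda_max :: "real ^ 'k ^ 'k \<Rightarrow> real" where
  "lambda_max A = Max (eigenvalues A)"

definition pos_def :: "real ^ 'k ^ 'k \<Rightarrow> bool" where
  "pos_def A \<longleftrightarrow> transpose A = A \<and> (\<forall>x. x \<noteq> 0 \<longrightarrow> 0 < x \<bullet> (A *v x))"

text \<open>The smallest eigenvalue of the \<open>n \<times> n\<close> matrix \<open>(A i j)\<close>, \<open>i, j < n\<close>.\<close>

definition lambda_min_n :: "nat \<Rightarrow> (nat \<Rightarrow> nat \<Rightarrow> real) \<Rightarrow> real" where
  "lambda_min_n n A =
     Min {e. \<exists>x. (\<exists>i<n. x i \<noteq> 0) \<and> (\<forall>i<n. (\<Sum>j<n. A i j * x j) = e * x i)}"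

section \<open>Probabilistic notions\<close>

definition cov :: "'w measure \<Rightarrow> ('w \<Rightarrow> real) \<Rightarrow> ('w \<Rightarrow> real) \<Rightarrow> real" where
  "cov M X Y = (LINT \<omega>|M. (X \<omega> - (LINT \<omega>'|M. X \<omega>')) * (Y \<omega> - (LINT \<omega>'|M. Y \<omega>')))"

text \<open>
  Independence of two random elements; unlike the library's \<open>indep_var\<close>, it allows them to take
  values in different types.
\<close>

definition indep_rv ::
  "'w measure \<Rightarrow> 'a measure \<Rightarrow> ('w \<Rightarrow> 'a) \<Rightarrow> 'b measure \<Rightarrow> ('w \<Rightarrow> 'b) \<Rightarrow> bool" where
  "indep_rv M S X N Y \<longleftrightarrow> X \<in> measurable M S \<and> Y \<in> measurable M N \<and>
     prob_space.indep_set M (sets (vimage_algebra (space M) X S)) (sets (vimage_algebra (space M) Y N))"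

text \<open>
  Measurability is part of the definition: the measure of a non-measurable set is 0, so without it
  the limit statement could hold for the wrong reason.
\<close>

definition conv_in_prob ::
  "'w measure \<Rightarrow> (nat \<Rightarrow> 'w \<Rightarrow> 'b::metric_space) \<Rightarrow> ('w \<Rightarrow> 'b) \<Rightarrow> bool" where
  "conv_in_prob M X L \<longleftrightarrow> (\<forall>n. X n \<in> borel_measurable M) \<and> L \<in> borel_measurable M \<and>
     (\<forall>\<epsilon>>0. (\<lambda>n. measure M {\<omega> \<in> space M. dist (X n \<omega>) (L \<omega>) > \<epsilon>}) \<longlonglongrightarrow> 0)"

text \<open>\<open>X\<^sub>n\<close> is of exact order \<open>g\<^sub>n\<close> in probability: both \<open>X\<^sub>n / g\<^sub>n\<close> and its inverse are tight.\<close>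

definition exact_order_p :: "'w measure \<Rightarrow> (nat \<Rightarrow> 'w \<Rightarrow> real) \<Rightarrow> (nat \<Rightarrow> real) \<Rightarrow> bool" where
  "exact_order_p M X g \<longleftrightarrow> (\<forall>\<epsilon>>0. \<exists>c>0. \<exists>C. \<forall>\<^sub>F n in sequentially.
     measure M {\<omega> \<in> space M. c * g n \<le> X n \<omega> \<and> X n \<omega> \<le> C * g n} \<ge> 1 - \<epsilon>)"

section \<open>Assumptions of the factor model\<close>

text \<open>
  In the bound on the largest eigenvalue of the inverse sample covariance matrix, the constant may
  depend on the path \<open>\<omega>\<close> but not on \<open>T\<close>. A nonrandom constant is incompatible with the linear
  process in the first part, whose innovations over \<open>T\<close> periods are nearly equal with positive
  probability. The mean of the linear process is the true mean \<open>\<mu>0\<close>.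
\<close>

definition assumption1 ::
  "'w measure \<Rightarrow> (nat \<Rightarrow> 'w \<Rightarrow> real ^ 'k) \<Rightarrow> real ^ 'k \<Rightarrow> nat \<Rightarrow> bool" where
  "assumption1 M f \<mu>0 T0 \<longleftrightarrow>
     (\<forall>t. f t \<in> borel_measurable M \<and> integrable M (f t) \<and> (LINT \<omega>|M. f t \<omega>) = \<mu>0) \<and>
     (\<exists>(\<zeta> :: int \<Rightarrow> 'w \<Rightarrow> real ^ 'k) (\<Psi> :: nat \<Rightarrow> real ^ 'k ^ 'k) C \<rho>.
        C > 0 \<and> 0 < \<rho> \<and> \<rho> < 1 \<and> norm \<mu>0 < C \<and>
        prob_space.indep_vars M (\<lambda>_. borel) \<zeta> UNIV \<and>
        (\<forall>s. distr M borel (\<zeta> s) = distr M borel (\<zeta> 0)) \<and>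
        (\<forall>s. integrable M (\<zeta> s) \<and> (LINT \<omega>|M. \<zeta> s \<omega>) = 0) \<and>
        (\<forall>s k l. integrable M (\<lambda>\<omega>. \<zeta> s \<omega> $ k * \<zeta> s \<omega> $ l) \<and>
                 (LINT \<omega>|M. \<zeta> s \<omega> $ k * \<zeta> s \<omega> $ l) = (if k = l then 1 else 0)) \<and>
        (\<forall>j. onorm ((*v) (\<Psi> j)) < C * \<rho> ^ j) \<and>
        (\<forall>t. AE \<omega> in M. (\<lambda>j. \<Psi> j *v \<zeta> (int t - int j) \<omega>) sums (f t \<omega> - \<mu>0))) \<and>
     (AE \<omega> in M. \<exists>C>0. \<forall>T>T0.
        full_column_rank T (\<lambda>t. f t \<omega>) \<and>
        pos_def ((1 / real T) *\<^sub>R gram T (\<lambda>t. f t \<omega>)) \<and>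
        lambda_max (matrix_inv ((1 / real T) *\<^sub>R gram T (\<lambda>t. f t \<omega>))) < C) \<and>
     (\<exists>\<Sigma>f :: real ^ 'k ^ 'k.
        (\<forall>t. \<Sigma>f = (\<chi> k l. LINT \<omega>|M. (f t \<omega> $ k - \<mu>0 $ k) * (f t \<omega> $ l - \<mu>0 $ l))) \<and>
        pos_def \<Sigma>f \<and>
        conv_in_prob M (\<lambda>T \<omega>. (1 / real T) *\<^sub>R gram T (\<lambda>t. f t \<omega>)) (\<lambda>_. \<Sigma>f))"

definition D_alpha :: "('k \<Rightarrow> real) \<Rightarrow> nat \<Rightarrow> real ^ 'k ^ 'k" where
  "D_alpha \<alpha> n = (\<chi> k l. if k = l then real n powr (\<alpha> k / 2) else 0)"

text \<open>
  The eigenvalue bounds are required with probability tending to one, since \<open>B\<^sub>n\<close> is random and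
  \<open>B\<^sub>n' M\<^sub>n B\<^sub>n\<close> is singular for \<open>n \<le> K\<close>.
\<close>

definition assumption2 ::
  "'w measure \<Rightarrow> (nat \<Rightarrow> 'w \<Rightarrow> real ^ 'k) \<Rightarrow> ('k \<Rightarrow> real) \<Rightarrow> bool" where
  "assumption2 M \<beta> \<alpha> \<longleftrightarrow>
     (\<forall>i. \<beta> i \<in> borel_measurable M) \<and>
     (\<exists>C. \<forall>i k. integrable M (\<lambda>\<omega>. (\<beta> i \<omega> $ k)\<^sup>2) \<and> (LINT \<omega>|M. (\<beta> i \<omega> $ k)\<^sup>2) < C) \<and>
     (\<forall>k. 0 < \<alpha> k \<and> \<alpha> k \<le> 1 \<and>
          exact_order_p M (\<lambda>n \<omega>. \<Sum>i<n. (\<beta> i \<omega> $ k - avg n (\<lambda>j. \<beta> j \<omega> $ k))\<^sup>2)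
            (\<lambda>n. real n powr \<alpha> k)) \<and>
     (\<exists>c>0. \<exists>C.
        (\<lambda>n. measure M {\<omega> \<in> space M.
           let A = matrix_inv (D_alpha \<alpha> n) ** gram n (\<lambda>i. \<beta> i \<omega>) ** matrix_inv (D_alpha \<alpha> n)
           in c < lambda_min A \<and> lambda_max A < C}) \<longlonglongrightarrow> 1)"

definition assumption3 ::
  "'w measure \<Rightarrow> (nat \<Rightarrow> 'w \<Rightarrow> real ^ 'k) \<Rightarrow> (nat \<Rightarrow> 'w \<Rightarrow> real) \<Rightarrow> (nat \<Rightarrow> 'w \<Rightarrow> real) \<Rightarrow> real \<Rightarrow> bool"
  where
  "assumption3 M f g \<gamma> \<alpha>\<gamma> \<longleftrightarrow>
     (\<forall>t t'. indep_rv M borel (g t) borel (f t')) \<and>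
     prob_space.indep_vars M (\<lambda>_. borel) g UNIV \<and>
     (\<forall>t. (LINT \<omega>|M. g t \<omega>) = 0 \<and> (LINT \<omega>|M. (g t \<omega>)\<^sup>2) = 1) \<and>
     (\<exists>C. \<forall>t. integrable M (\<lambda>\<omega>. g t \<omega> ^ 4) \<and> (LINT \<omega>|M. g t \<omega> ^ 4) < C) \<and>
     (\<forall>i. \<gamma> i \<in> borel_measurable M) \<and>
     (\<exists>C. AE \<omega> in M. \<forall>i. \<bar>\<gamma> i \<omega>\<bar> < C) \<and>
     (AE \<omega> in M. (\<lambda>n. \<Sum>i<n. \<bar>\<gamma> i \<omega>\<bar>) \<in> O(\<lambda>n. real n powr \<alpha>\<gamma>))"

text \<open>
  The idiosyncratic errors, as a family, are independent of the joint family of factors and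
  loadings, and the cross sections \<open>(v\<^sub>i\<^sub>t)\<^sub>i\<close> are independent over \<open>t\<close>. The limit law is written as
  the law of \<open>w Z\<close> with \<open>Z\<close> standard normal, which covers a zero limiting variance.
\<close>

definition assumption4 ::
  "'w measure \<Rightarrow> (nat \<Rightarrow> 'w \<Rightarrow> real ^ 'k) \<Rightarrow> (nat \<Rightarrow> 'w \<Rightarrow> real) \<Rightarrow> (nat \<Rightarrow> 'w \<Rightarrow> real ^ 'k) \<Rightarrow>
   (nat \<Rightarrow> 'w \<Rightarrow> real) \<Rightarrow> (nat \<Rightarrow> nat \<Rightarrow> 'w \<Rightarrow> real) \<Rightarrow> bool" where
  "assumption4 M f g \<beta> \<gamma> v \<longleftrightarrow>
     (\<exists>\<sigma>v :: nat \<Rightarrow> nat \<Rightarrow> real.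
        indep_rv M (\<Pi>\<^sub>M (i, t) \<in> UNIV. borel) (\<lambda>\<omega> (i, t). v i t \<omega>)
          ((\<Pi>\<^sub>M t \<in> UNIV. borel) \<Otimes>\<^sub>M (\<Pi>\<^sub>M t \<in> UNIV. borel) \<Otimes>\<^sub>M
           (\<Pi>\<^sub>M i \<in> UNIV. borel) \<Otimes>\<^sub>M (\<Pi>\<^sub>M i \<in> UNIV. borel))
          (\<lambda>\<omega>. (\<lambda>t. f t \<omega>, \<lambda>t. g t \<omega>, \<lambda>i. \<beta> i \<omega>, \<lambda>i. \<gamma> i \<omega>)) \<and>
        prob_space.indep_vars M (\<lambda>_. \<Pi>\<^sub>M i \<in> UNIV. borel) (\<lambda>t \<omega> i. v i t \<omega>) UNIV \<and>
        (\<forall>i t. (LINT \<omega>|M. v i t \<omega>) = 0 \<and> integrable M (\<lambda>\<omega>. v i t \<omega> ^ 4)) \<and>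
        (\<forall>i j t. (LINT \<omega>|M. v i t \<omega> * v j t \<omega>) = \<sigma>v i j) \<and>
        (\<exists>C. \<forall>n. \<forall>i<n. (\<Sum>j<n. \<bar>\<sigma>v i j\<bar>) \<le> C) \<and>
        (\<forall>t. \<exists>C. \<forall>n. \<forall>i<n. (\<Sum>j<n. cov M (\<lambda>\<omega>. (v i t \<omega>)\<^sup>2) (\<lambda>\<omega>. (v j t \<omega>)\<^sup>2)) \<le> C) \<and>
        (\<forall>n\<ge>1. 0 < lambda_min_n n \<sigma>v) \<and>
        (\<forall>k. \<exists>w\<ge>0.
           conv_in_prob M
             (\<lambda>n \<omega>. 1 / real n * (\<Sum>i<n. \<Sum>j<n. (\<beta> i \<omega> $ k - avg n (\<lambda>l. \<beta> l \<omega> $ k)) *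
                (\<beta> j \<omega> $ k - avg n (\<lambda>l. \<beta> l \<omega> $ k)) * \<sigma>v i j))
             (\<lambda>_. w\<^sup>2) \<and>
           (\<forall>T\<ge>1. weak_conv_m
             (\<lambda>n. distr M borel (\<lambda>\<omega>. 1 / (sqrt (real T) * sqrt (real n)) *
                (\<Sum>t<T. \<Sum>i<n. (\<beta> i \<omega> $ k - avg n (\<lambda>l. \<beta> l \<omega> $ k)) * v i t \<omega>)))
             (distr std_normal_distribution borel (\<lambda>z. w * z)))))"

definition assumption5 ::
  "'w measure \<Rightarrow> (nat \<Rightarrow> 'w \<Rightarrow> real ^ 'k) \<Rightarrow> (nat \<Rightarrow> 'w \<Rightarrow> real) \<Rightarrow> (nat \<Rightarrow> 'w \<Rightarrow> real) \<Rightarrow> real \<Rightarrow> bool"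
  where
  "assumption5 M \<beta> \<gamma> \<eta> \<alpha>\<eta> \<longleftrightarrow>
     (\<exists>C. AE \<omega> in M. \<forall>i. \<bar>\<eta> i \<omega>\<bar> < C) \<and>
     indep_rv M (\<Pi>\<^sub>M i \<in> UNIV. borel) (\<lambda>\<omega> i. \<eta> i \<omega>)
       ((\<Pi>\<^sub>M i \<in> UNIV. borel) \<Otimes>\<^sub>M (\<Pi>\<^sub>M i \<in> UNIV. borel)) (\<lambda>\<omega>. (\<lambda>i. \<beta> i \<omega>, \<lambda>i. \<gamma> i \<omega>)) \<and>
     (AE \<omega> in M. (\<lambda>n. \<Sum>i<n. \<bar>\<eta> i \<omega>\<bar>) \<in> O(\<lambda>n. real n powr \<alpha>\<eta>)) \<and>
     \<alpha>\<eta> < 1 / 2"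

section \<open>Fama--MacBeth two-pass estimator\<close>

text \<open>First pass: \<open>(F' M\<^sub>T F)\<^sup>-\<^sup>1 F' M\<^sub>T r\<^sub>i\<close>, the time-series regression of unit \<open>i\<close>.\<close>

definition beta_hat ::
  "nat \<Rightarrow> (nat \<Rightarrow> real ^ 'k) \<Rightarrow> (nat \<Rightarrow> nat \<Rightarrow> real) \<Rightarrow> nat \<Rightarrow> real ^ 'k" where
  "beta_hat T F r i = matrix_inv (gram T F) *v cross T F (r i)"

text \<open>Second pass: the cross-section regression of mean returns on the estimated loadings.\<close>

definition lambda_hat ::
  "nat \<Rightarrow> nat \<Rightarrow> (nat \<Rightarrow> real ^ 'k) \<Rightarrow> (nat \<Rightarrow> nat \<Rightarrow> real) \<Rightarrow> real ^ 'k" where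
  "lambda_hat n T F r =
     matrix_inv (gram n (beta_hat T F r)) *v cross n (beta_hat T F r) (\<lambda>i. avg T (r i))"

end

theory Submission
  imports Defs
begin

text \<open>
  Only \<open>n\<close> grows, so the first-pass weights \<open>w\<^sub>t = (F' M\<^sub>T F)\<^sup>-\<^sup>1 (f\<^sub>t - \<mu>\<^sub>T)\<close> are fixed on each path. They satisfy
  \<open>\<Sum> w\<^sub>t = 0\<close> and \<open>\<Sum> w\<^sub>t w\<^sub>t' = (F' M\<^sub>T F)\<^sup>-\<^sup>1\<close>, and the estimated loadings are \<open>\<beta>\<^sub>i + \<Sum> u\<^sub>i\<^sub>t w\<^sub>t\<close>. The second
  pass is therefore a continuous function of the cross-sectional covariances of \<open>\<beta>\<^sub>i\<^sub>k\<close>, \<open>u\<^sub>i\<^sub>t\<close> and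
  \<open>\<eta>\<^sub>i\<close>. Those of \<open>u\<^sub>i\<^sub>s\<close> and \<open>u\<^sub>i\<^sub>t\<close> tend to \<open>\<sigma>bar2\<close> for \<open>s = t\<close> and to 0 otherwise, which produces the bias;
  those of \<open>\<beta>\<^sub>i\<^sub>k\<close> with \<open>u\<^sub>i\<^sub>t\<close> and all those with \<open>\<eta>\<^sub>i\<close> vanish. The missing factor and the pricing errors
  drop out by Cauchy--Schwarz because their mean squares tend to 0, and second moments control the
  terms in \<open>v\<^sub>i\<^sub>t\<close>. Passing to almost surely convergent subsequences replaces a continuous mapping
  theorem.
\<close>

section \<open>Sample covariances\<close>

text \<open>The divisor is \<open>n\<close>, so centred matrix products become \<open>n\<close>
  times a sample covariance. For \<open>n = 0\<close> division by zero gives 0, which keeps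
  bilinearity free of side conditions.\<close>

definition scov :: "nat \<Rightarrow> (nat \<Rightarrow> real) \<Rightarrow> (nat \<Rightarrow> real) \<Rightarrow> real" where
  "scov n x y = avg n (\<lambda>i. x i * y i) - avg n x * avg n y"

lemma scov_commute: "scov n x y = scov n y x"
  by (simp add: scov_def mult.commute)

lemma scov_add_left: "scov n (\<lambda>i. x i + y i) z = scov n x z + scov n y z"
  by (simp add: scov_def avg_def sum.distrib algebra_simps)

lemma scov_add_right: "scov n z (\<lambda>i. x i + y i) = scov n z x + scov n z y"
  by (metis scov_add_left scov_commute)

lemma scov_cmult_left: "scov n (\<lambda>i. a * x i) y = a * scov n x y"
  by (simp add: scov_def avg_def sum_distrib_left[symmetric] algebra_simps)

lemma scov_cmult_right: "scov n x (\<lambda>i. a * y i) = a * scov n x y"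
  by (metis scov_cmult_left scov_commute)

lemma scov_zero_left: "scov n (\<lambda>i. 0) x = 0"
  by (simp add: scov_def avg_def)

lemma scov_const_right: "scov n x (\<lambda>i. a) = 0"
  by (cases "n = 0") (simp_all add: scov_def avg_def sum_distrib_left[symmetric] sum_distrib_right[symmetric])

lemma scov_sum_left: "finite A \<Longrightarrow> scov n (\<lambda>i. \<Sum>a\<in>A. x a i) y = (\<Sum>a\<in>A. scov n (x a) y)"
  by (induction A rule: finite_induct) (simp_all add: scov_zero_left scov_add_left)

lemma scov_sum_right: "finite A \<Longrightarrow> scov n y (\<lambda>i. \<Sum>a\<in>A. x a i) = (\<Sum>a\<in>A. scov n y (x a))"
  by (simp add: scov_commute[of n y] scov_sum_left)

lemma scov_centered: "scov n x y = avg n (\<lambda>i. (x i - avg n x) * (y i - avg n y))"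
proof (cases "n = 0")
  case False
  have "(\<Sum>i<n. (x i - a) * (y i - b)) = (\<Sum>i<n. x i * y i) - (\<Sum>i<n. x i) * b - a * (\<Sum>i<n. y i) + n * (a * b)"
    for a b :: real
    by (simp add: algebra_simps sum.distrib sum_subtractf sum_distrib_left)
  from this[of "avg n x" "avg n y"] show ?thesis
    using False by (simp add: scov_def avg_def field_simps)
qed (simp add: scov_def avg_def)

lemma scov_centered_left: "scov n x y = avg n (\<lambda>i. (x i - avg n x) * y i)"
proof -
  have "(\<Sum>i<n. (x i - a) * y i) = (\<Sum>i<n. x i * y i) - a * (\<Sum>i<n. y i)" for a :: real
    by (simp add: left_diff_distrib sum_subtractf sum_distrib_left)
  from this[of "avg n x"] show ?thesis
    by (simp add: scov_def avg_def right_diff_distrib)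
qed

lemma scov_self_nonneg: "0 \<le> scov n x x"
  unfolding scov_centered by (simp add: avg_def sum_nonneg)

lemma scov_self_le: "scov n x x \<le> avg n (\<lambda>i. (x i)\<^sup>2)"
  by (simp add: scov_def power2_eq_square)

lemma scov_cauchy_schwarz: "(scov n x y)\<^sup>2 \<le> scov n x x * scov n y y"
proof -
  have "(\<Sum>i<n. (x i - avg n x) * (y i - avg n y))\<^sup>2
      \<le> (\<Sum>i<n. (x i - avg n x)\<^sup>2) * (\<Sum>i<n. (y i - avg n y)\<^sup>2)"
    by (rule Cauchy_Schwarz_ineq_sum)
  from mult_left_mono[OF this, of "(1 / real n)\<^sup>2"] show ?thesis
    unfolding scov_centered by (simp add: avg_def power2_eq_square algebra_simps)
qed

text \<open>Cauchy-Schwarz: one variance vanishes while the other stays bounded because it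
  converges. This removes every term in the missing factor's loadings and in the pricing errors,
  whatever their dependence on the other variable.\<close>

lemma tendsto_scov_null:
  assumes "((\<lambda>n. scov n z z) \<longlongrightarrow> 0) Fl" and "((\<lambda>n. scov n x x) \<longlongrightarrow> L) Fl"
  shows "((\<lambda>n. scov n z x) \<longlongrightarrow> 0) Fl"
proof (rule Lim_null_comparison)
  show "((\<lambda>n. sqrt (scov n z z * scov n x x)) \<longlongrightarrow> 0) Fl"
    using tendsto_real_sqrt[OF tendsto_mult[OF assms]] by simp
  show "\<forall>\<^sub>F n in Fl. norm (scov n z x) \<le> sqrt (scov n z z * scov n x x)"
    by (rule always_eventually) (simp add: real_le_rsqrt scov_cauchy_schwarz)
qed

lemma avg_power2_le: "(avg n x)\<^sup>2 \<le> avg n (\<lambda>i. (x i)\<^sup>2)" for x :: "nat \<Rightarrow> real"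
  using scov_self_nonneg[of n x] by (simp add: scov_def power2_eq_square)

text \<open>Boundedness gives \<open>(x i)\<^sup>2 \<le> C * \<bar>x i\<bar>\<close>, so the mean
  square is of order \<open>n powr (\<alpha> - 1)\<close>, a negative power of
  \<open>n\<close>.\<close>

lemma avg_square_tendsto_zero_if_sparse:
  fixes x :: "nat \<Rightarrow> real"
  assumes bound: "\<And>i. \<bar>x i\<bar> < C" and O: "(\<lambda>n. \<Sum>i<n. \<bar>x i\<bar>) \<in> O(\<lambda>n. real n powr \<alpha>)" and "\<alpha> < 1"
  shows "(\<lambda>n. avg n (\<lambda>i. (x i)\<^sup>2)) \<longlonglongrightarrow> 0"
proof -
  from O obtain K where K: "\<forall>\<^sub>F n in sequentially. norm (\<Sum>i<n. \<bar>x i\<bar>) \<le> K * norm (real n powr \<alpha>)"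
    by (elim landau_o.bigE)
  have C: "0 < C"
    using bound[of 0] by linarith
  have "((\<lambda>n. real n powr (\<alpha> - 1)) \<longlonglongrightarrow> 0)"
    using \<open>\<alpha> < 1\<close> by (intro tendsto_neg_powr filterlim_real_sequentially) simp
  then have lim: "(\<lambda>n. C * K * real n powr (\<alpha> - 1)) \<longlonglongrightarrow> 0"
    by (rule tendsto_mult_right_zero)
  show ?thesis
  proof (rule Lim_null_comparison[OF _ lim])
    show "\<forall>\<^sub>F n in sequentially. norm (avg n (\<lambda>i. (x i)\<^sup>2)) \<le> C * K * real n powr (\<alpha> - 1)"
      using K eventually_gt_at_top[of 0]
    proof eventually_elim
      case (elim n)
      have "(x i)\<^sup>2 \<le> C * \<bar>x i\<bar>" for i
        using mult_right_mono[of "\<bar>x i\<bar>" C "\<bar>x i\<bar>"] bound[of i] by (simp add: power2_eq_square)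
      then have "(\<Sum>i<n. (x i)\<^sup>2) \<le> C * (\<Sum>i<n. \<bar>x i\<bar>)"
        unfolding sum_distrib_left by (rule sum_mono)
      also have "\<dots> \<le> C * (K * real n powr \<alpha>)"
        using elim C by (intro mult_left_mono) auto
      finally have "avg n (\<lambda>i. (x i)\<^sup>2) \<le> C * (K * real n powr \<alpha>) / real n"
        by (simp add: avg_def divide_right_mono)
      also have "\<dots> = C * K * real n powr (\<alpha> - 1)"
        using elim by (simp add: powr_diff)
      finally show ?case
        by (simp add: avg_def sum_nonneg)
    qed
  qed
qed

section \<open>Products with the centring matrix as sample covariances\<close>

lemma sum_cmat:
  "(\<Sum>s<m. \<Sum>t<m. x s * cmat m s t * y t) = real m * scov m x y"
proof (cases "m = 0")
  case False
  have "(\<Sum>t<m. x s * cmat m s t * y t) = x s * y s - x s * (1 / real m) * (\<Sum>t<m. y t)" if "s < m" for s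
  proof -
    have "(\<Sum>t<m. x s * cmat m s t * y t)
        = (\<Sum>t<m. (if s = t then x s * y t else 0)) - (\<Sum>t<m. x s * (1 / real m) * y t)"
      unfolding sum_subtractf[symmetric] by (rule sum.cong) (auto simp: cmat_def algebra_simps)
    then show ?thesis
      using that by (simp add: sum_distrib_left)
  qed
  then have "(\<Sum>s<m. \<Sum>t<m. x s * cmat m s t * y t)
      = (\<Sum>s<m. x s * y s - x s * (1 / real m) * (\<Sum>t<m. y t))"
    by (intro sum.cong) auto
  also have "\<dots> = (\<Sum>s<m. x s * y s) - (1 / real m) * (\<Sum>s<m. x s) * (\<Sum>t<m. y t)"
    by (simp add: sum_subtractf sum_divide_distrib[symmetric] sum_distrib_right[symmetric])
  finally show ?thesis
    using False by (simp add: scov_def avg_def right_diff_distrib)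
qed simp

lemma gram_nth: "gram m X $ k $ l = real m * scov m (\<lambda>i. X i $ k) (\<lambda>i. X i $ l)"
  by (simp add: gram_def sum_cmat)

lemma cross_nth: "cross m X y $ k = real m * scov m (\<lambda>i. X i $ k) y"
  by (simp add: cross_def sum_cmat)

lemma avg_nth: "avg m X $ k = avg m (\<lambda>i. X i $ k)"
  by (simp add: avg_def)

text \<open>The centring matrix is moved entirely onto \<open>X\<close>, which exhibits the product
  as linear in \<open>y\<close> with weights depending on \<open>X\<close> only.\<close>

lemma cross_eq_sum: "cross m X y = (\<Sum>t<m. y t *\<^sub>R (X t - avg m X))"
proof (cases "m = 0")
  case False
  then show ?thesis
    by (simp add: vec_eq_iff cross_nth scov_centered_left avg_nth)
       (simp add: avg_def mult.commute)
qed (simp add: cross_def vec_eq_iff)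

text \<open>These are the normal equations for a response that is an exact linear function of the
  regressors; they make least squares recover \<open>z\<close>.\<close>

lemma cross_inner: "cross m X (\<lambda>t. X t \<bullet> z) = gram m X *v z"
proof -
  have "X t \<bullet> z = (\<Sum>l\<in>UNIV. z $ l * X t $ l)" for t
    by (simp add: inner_vec_def mult.commute)
  then show ?thesis
    by (simp add: vec_eq_iff cross_nth gram_nth matrix_vector_mult_def scov_sum_right scov_cmult_right
        sum_distrib_left)
       (simp add: mult_ac)
qed

lemma cross_const: "cross m X (\<lambda>t. a) = 0"
  by (simp add: vec_eq_iff cross_nth scov_const_right)

section \<open>The inverse matrix\<close>

lemma matrix_inv_right:
  fixes A :: "real ^ 'k ^ 'k"
  shows "invertible A \<Longrightarrow> A ** matrix_inv A = mat 1"
  unfolding matrix_inv_def invertible_def by (rule someI2_ex) auto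

lemma matrix_inv_left:
  fixes A :: "real ^ 'k ^ 'k"
  shows "invertible A \<Longrightarrow> matrix_inv A ** A = mat 1"
  unfolding matrix_inv_def invertible_def by (rule someI2_ex) auto

lemma matrix_inv_unique:
  fixes A B :: "real ^ 'k ^ 'k"
  assumes "A ** B = mat 1"
  shows "matrix_inv A = B"
proof -
  have BA: "B ** A = mat 1"
    using assms by (simp add: matrix_left_right_inverse)
  then have inv: "invertible A"
    using assms by (auto simp: invertible_def)
  have "matrix_inv A = matrix_inv A ** (A ** B)"
    by (simp add: assms)
  also have "\<dots> = B"
    by (simp add: matrix_mul_assoc matrix_inv_left[OF inv])
  finally show ?thesis .
qed

lemma matrix_inv_scaleR:
  fixes A :: "real ^ 'k ^ 'k"
  assumes "invertible A" "a \<noteq> 0"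
  shows "matrix_inv (a *\<^sub>R A) = (1 / a) *\<^sub>R matrix_inv A"
proof (rule matrix_inv_unique)
  have "(a *\<^sub>R A) ** ((1 / a) *\<^sub>R matrix_inv A) = (a * (1 / a)) *\<^sub>R (A ** matrix_inv A)"
    by (simp add: matrix_matrix_mult_def vec_eq_iff sum_divide_distrib sum_distrib_left mult_ac)
  then show "(a *\<^sub>R A) ** ((1 / a) *\<^sub>R matrix_inv A) = mat 1"
    using assms by (simp add: matrix_inv_right)
qed

text \<open>Cramer's rule applied to the \<open>l\<close>-th column of the inverse. Entries of the
  inverse become quotients of polynomials in the entries of \<open>A\<close>, from which both
  continuity and measurability of \<open>matrix_inv\<close> follow.\<close>

lemma matrix_inv_cramer:
  fixes A :: "real ^ 'k ^ 'k"
  assumes "det A \<noteq> 0"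
  shows "matrix_inv A $ k $ l = det (\<chi> i j. if j = k then axis l 1 $ i else A $ i $ j) / det A"
proof -
  have "invertible A"
    using assms by (simp add: invertible_det_nz)
  then have "A *v (matrix_inv A *v axis l 1) = axis l 1"
    by (simp add: matrix_vector_mul_assoc matrix_inv_right)
  then have "matrix_inv A *v axis l 1 = (\<chi> k. det (\<chi> i j. if j = k then axis l 1 $ i else A $ i $ j) / det A)"
    using cramer[OF assms] by blast
  then have "(matrix_inv A *v axis l 1) $ k = det (\<chi> i j. if j = k then axis l 1 $ i else A $ i $ j) / det A"
    by simp
  then show ?thesis
    by (simp add: matrix_vector_mul_component inner_axis)
qed

lemma tendsto_det:
  fixes A :: "'a \<Rightarrow> real ^ 'k ^ 'k"
  assumes "\<And>i j. ((\<lambda>x. A x $ i $ j) \<longlongrightarrow> L $ i $ j) Fl"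
  shows "((\<lambda>x. det (A x)) \<longlongrightarrow> det L) Fl"
  unfolding det_def by (intro tendsto_intros assms)

lemma tendsto_matrix_inv:
  fixes A :: "'a \<Rightarrow> real ^ 'k ^ 'k"
  assumes "(A \<longlongrightarrow> L) Fl" "invertible L"
  shows "((\<lambda>x. matrix_inv (A x)) \<longlongrightarrow> matrix_inv L) Fl"
proof (intro vec_tendstoI)
  fix k l
  have A: "((\<lambda>x. A x $ i $ j) \<longlongrightarrow> L $ i $ j) Fl" for i j
    by (intro tendsto_intros assms)
  have L: "det L \<noteq> 0"
    using assms by (simp add: invertible_det_nz)
  have det: "((\<lambda>x. det (A x)) \<longlongrightarrow> det L) Fl"
    by (intro tendsto_det A)
  have "((\<lambda>x. det (\<chi> i j. if j = k then axis l 1 $ i else A x $ i $ j) / det (A x))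
      \<longlongrightarrow> det (\<chi> i j. if j = k then axis l 1 $ i else L $ i $ j) / det L) Fl"
    by (intro tendsto_divide det L tendsto_det) (simp add: A)
  moreover have "\<forall>\<^sub>F x in Fl. det (\<chi> i j. if j = k then axis l 1 $ i else A x $ i $ j) / det (A x)
      = matrix_inv (A x) $ k $ l"
    \<comment> \<open>Cramer's rule holds for \<open>A x\<close> only once its determinant is
      nonzero, which is eventually the case because \<open>det L\<close> is nonzero.\<close>
    using tendsto_imp_eventually_ne[OF det L] by eventually_elim (simp add: matrix_inv_cramer)
  ultimately show "((\<lambda>x. matrix_inv (A x) $ k $ l) \<longlongrightarrow> matrix_inv L $ k $ l) Fl"
    unfolding matrix_inv_cramer[OF L] by (rule Lim_transform_eventually)
qed

section \<open>Matrices with positive quadratic form\<close>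

lemma invertible_if_inner_pos:
  fixes A :: "real ^ 'k ^ 'k"
  assumes "\<And>x. x \<noteq> 0 \<Longrightarrow> 0 < x \<bullet> (A *v x)"
  shows "invertible A"
proof -
  have "x = 0" if "A *v x = 0" for x
    using assms[of x] that by fastforce
  then show ?thesis
    by (simp add: invertible_left_inverse matrix_left_invertible_ker)
qed

text \<open>With \<open>y = matrix_inv A *v x\<close> the form at \<open>x\<close> equals
  \<open>y \<bullet> (A *v y)\<close>, and \<open>y\<close> is nonzero because
  \<open>A *v y = x\<close>.\<close>

lemma inner_matrix_inv_pos:
  fixes A :: "real ^ 'k ^ 'k"
  assumes "\<And>x. x \<noteq> 0 \<Longrightarrow> 0 < x \<bullet> (A *v x)" "x \<noteq> 0"
  shows "0 < x \<bullet> (matrix_inv A *v x)"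
proof -
  have "A *v (matrix_inv A *v x) = x"
    using invertible_if_inner_pos[OF assms(1)] by (simp add: matrix_vector_mul_assoc matrix_inv_right)
  moreover from this have "matrix_inv A *v x \<noteq> 0"
    using assms(2) by auto
  ultimately show ?thesis
    using assms(1)[of "matrix_inv A *v x"] by (simp add: inner_commute)
qed

lemma matrix_vector_mult_sum_right: "A *v (\<Sum>i\<in>I. x i) = (\<Sum>i\<in>I. (A :: real ^ 'k ^ 'k) *v x i)"
  by (rule linear_sum[OF matrix_vector_mul_linear])

section \<open>Pathwise limit of the two-pass estimator\<close>

definition ols_weight :: "nat \<Rightarrow> (nat \<Rightarrow> real ^ 'k) \<Rightarrow> nat \<Rightarrow> real ^ 'k" where
  "ols_weight T F t = matrix_inv (gram T F) *v (F t - avg T F)"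

lemma beta_hat_eq_sum: "beta_hat T F r i = (\<Sum>t<T. r i t *\<^sub>R ols_weight T F t)"
  by (simp add: beta_hat_def cross_eq_sum ols_weight_def matrix_vector_mult_sum_right matrix_vector_mult_scaleR)

text \<open>A constant response has zero least-squares slope. In the first pass this removes
  everything that does not vary over time, including the pricing error.\<close>

lemma sum_ols_weight: "(\<Sum>t<T. ols_weight T F t) = 0"
  using cross_const[of T F 1]
  by (simp add: cross_eq_sum ols_weight_def flip: matrix_vector_mult_sum_right)

lemma sum_inner_ols_weight:
  assumes "invertible (gram T F)"
  shows "(\<Sum>t<T. (F t \<bullet> z) *\<^sub>R ols_weight T F t) = z"
proof -
  have "(\<Sum>t<T. (F t \<bullet> z) *\<^sub>R ols_weight T F t) = matrix_inv (gram T F) *v cross T F (\<lambda>t. F t \<bullet> z)"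
    by (simp add: cross_eq_sum ols_weight_def matrix_vector_mult_sum_right matrix_vector_mult_scaleR)
  then show ?thesis
    using assms by (simp add: cross_inner matrix_vector_mul_assoc matrix_inv_left)
qed

text \<open>With \<open>a\<close> the \<open>k\<close>-th row of the inverse, the
  \<open>k\<close>-th weight is \<open>F t \<bullet> a\<close> up to a constant in \<open>t\<close>.
  The constant is killed by \<open>sum_ols_weight\<close>, and \<open>sum_inner_ols_weight\<close>
  returns \<open>a\<close>, whose \<open>l\<close>-th entry is the claim.\<close>

lemma sum_ols_weight_prod:
  assumes "invertible (gram T F)"
  shows "(\<Sum>t<T. ols_weight T F t $ k * ols_weight T F t $ l) = matrix_inv (gram T F) $ k $ l"
proof -
  define a where "a = row k (matrix_inv (gram T F))"
  have "ols_weight T F t $ k = F t \<bullet> a - avg T F \<bullet> a" for t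
    by (simp add: ols_weight_def a_def matrix_vector_mul_component row_def vec_lambda_eta inner_commute inner_diff_right)
  then have "(\<Sum>t<T. ols_weight T F t $ k * ols_weight T F t $ l)
      = (\<Sum>t<T. (F t \<bullet> a) *\<^sub>R ols_weight T F t) $ l - (avg T F \<bullet> a) * (\<Sum>t<T. ols_weight T F t) $ l"
    by (simp add: sum_distrib_left left_diff_distrib sum_subtractf)
  then show ?thesis
    by (simp add: sum_inner_ols_weight[OF assms] sum_ols_weight) (simp add: a_def row_def)
qed

text \<open>A deterministic statement about one path. The general filter \<open>Fl\<close> allows
  limits along a subsequence while \<open>n\<close> remains the sample size. The covariance of the
  estimated loadings tends to \<open>S\<close> plus a noise term, whereas their covariance with mean
  returns tends to \<open>S *v lam\<close> without one; this mismatch is the bias.\<close>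

lemma fama_macbeth_limit:
  fixes F B :: "nat \<Rightarrow> real ^ 'k" and S :: "real ^ 'k ^ 'k" and U :: "nat \<Rightarrow> nat \<Rightarrow> real"
  assumes Fl: "Fl \<noteq> bot" "Fl \<le> sequentially"
    and T: "0 < T" and pd: "pos_def ((1 / real T) *\<^sub>R gram T F)"
    and \<sigma>: "0 < \<sigma>"
    and BB: "\<And>k l. ((\<lambda>n. scov n (\<lambda>i. B i $ k) (\<lambda>i. B i $ l)) \<longlongrightarrow> S $ k $ l) Fl"
    and BU: "\<And>k t. t < T \<Longrightarrow> ((\<lambda>n. scov n (\<lambda>i. B i $ k) (\<lambda>i. U i t)) \<longlongrightarrow> 0) Fl"
    and UU: "\<And>s t. s < T \<Longrightarrow> t < T \<Longrightarrow>
      ((\<lambda>n. scov n (\<lambda>i. U i s) (\<lambda>i. U i t)) \<longlongrightarrow> (if s = t then \<sigma> else 0)) Fl"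
    and ee: "((\<lambda>n. scov n e e) \<longlongrightarrow> 0) Fl"
    and r: "\<And>i t. r i t = (c + B i \<bullet> \<phi> + e i) + B i \<bullet> F t + U i t"
  defines "Sinv \<equiv> matrix_inv ((1 / real T) *\<^sub>R gram T F)"
  defines "lam \<equiv> \<phi> + avg T F"
  shows "((\<lambda>n. lambda_hat n T F r) \<longlongrightarrow>
    lam - (\<sigma> / real T) *\<^sub>R (matrix_inv (S + (\<sigma> / real T) *\<^sub>R Sinv) *v (Sinv *v lam))) Fl"
proof -
  let ?W = "ols_weight T F" and ?b = "beta_hat T F r" and ?y = "\<lambda>i. avg T (r i)"
  define \<Gamma> where "\<Gamma> = S + (\<sigma> / real T) *\<^sub>R Sinv"
  have invG: "invertible (gram T F)"
  proof (rule invertible_if_inner_pos)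
    fix x :: "real ^ 'k" assume "x \<noteq> 0"
    then have "0 < x \<bullet> (((1 / real T) *\<^sub>R gram T F) *v x)"
      using pd by (simp add: pos_def_def)
    then show "0 < x \<bullet> (gram T F *v x)"
      using T by (simp add: scaleR_matrix_vector_assoc[symmetric] zero_less_divide_iff)
  qed
  have Sinv_eq: "Sinv = real T *\<^sub>R matrix_inv (gram T F)"
    using T invG by (simp add: Sinv_def matrix_inv_scaleR)
  have Sinv_pos: "0 < x \<bullet> (Sinv *v x)" if "x \<noteq> 0" for x
    unfolding Sinv_def using pd that by (intro inner_matrix_inv_pos) (auto simp: pos_def_def)
  \<comment> \<open>The quadratic form of \<open>S\<close> is a limit of sample variances of the
    combinations \<open>x \<bullet> B i\<close>; \<open>Fl \<noteq> bot\<close> lets the sign pass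
    to the limit.\<close>
  have S_nonneg: "0 \<le> x \<bullet> (S *v x)" for x
  proof -
    have "((\<lambda>n. \<Sum>k\<in>UNIV. \<Sum>l\<in>UNIV. x $ k * (scov n (\<lambda>i. B i $ k) (\<lambda>i. B i $ l) * x $ l))
        \<longlongrightarrow> (\<Sum>k\<in>UNIV. \<Sum>l\<in>UNIV. x $ k * (S $ k $ l * x $ l))) Fl"
      by (intro tendsto_intros BB)
    moreover have "(\<Sum>k\<in>UNIV. \<Sum>l\<in>UNIV. x $ k * (scov n (\<lambda>i. B i $ k) (\<lambda>i. B i $ l) * x $ l))
        = scov n (\<lambda>i. \<Sum>k\<in>UNIV. x $ k * B i $ k) (\<lambda>i. \<Sum>k\<in>UNIV. x $ k * B i $ k)" for n
      by (simp add: scov_sum_left scov_sum_right scov_cmult_left scov_cmult_right sum_distrib_left mult_ac)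
    ultimately have "0 \<le> (\<Sum>k\<in>UNIV. \<Sum>l\<in>UNIV. x $ k * (S $ k $ l * x $ l))"
      by (intro tendsto_lowerbound[OF _ _ Fl(1)]) (auto intro: always_eventually simp: scov_self_nonneg)
    also have "\<dots> = x \<bullet> (S *v x)"
      by (simp add: inner_vec_def matrix_vector_mult_def sum_distrib_left)
    finally show ?thesis .
  qed
  have inv\<Gamma>: "invertible \<Gamma>"
  proof (rule invertible_if_inner_pos)
    fix x :: "real ^ 'k" assume "x \<noteq> 0"
    then show "0 < x \<bullet> (\<Gamma> *v x)"
      using Sinv_pos[of x] S_nonneg[of x] T \<sigma>
      by (simp add: \<Gamma>_def matrix_vector_mult_add_rdistrib inner_add_right scaleR_matrix_vector_assoc[symmetric]
          add_nonneg_pos)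
  qed
  \<comment> \<open>The time-constant part meets weights summing to zero, and the factor part is
    reproduced exactly as \<open>B i\<close>; only the errors remain.\<close>
  have b: "?b i = B i + (\<Sum>t<T. U i t *\<^sub>R ?W t)" for i
  proof -
    have "?b i = (c + B i \<bullet> \<phi> + e i) *\<^sub>R (\<Sum>t<T. ?W t) + (\<Sum>t<T. (F t \<bullet> B i) *\<^sub>R ?W t) + (\<Sum>t<T. U i t *\<^sub>R ?W t)"
      unfolding beta_hat_eq_sum r by (simp add: scaleR_add_left sum.distrib scaleR_sum_right inner_commute)
    then show ?thesis
      by (simp add: sum_ols_weight sum_inner_ols_weight[OF invG])
  qed
  have bk: "(\<lambda>i. ?b i $ k) = (\<lambda>i. B i $ k + (\<Sum>t<T. ?W t $ k * U i t))" for k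
    by (simp add: b fun_eq_iff mult.commute)
  have y: "?y i = c + (\<Sum>k\<in>UNIV. lam $ k * B i $ k) + e i + (\<Sum>t<T. (1 / real T) * U i t)" for i
  proof -
    have "?y i = c + (B i \<bullet> \<phi> + B i \<bullet> avg T F) + e i + (\<Sum>t<T. (1 / real T) * U i t)"
      unfolding r using T by (simp add: avg_def sum.distrib inner_sum_right[symmetric] sum_divide_distrib[symmetric] field_simps)
    also have "B i \<bullet> \<phi> + B i \<bullet> avg T F = (\<Sum>k\<in>UNIV. lam $ k * B i $ k)"
      by (simp add: lam_def inner_vec_def sum.distrib algebra_simps)
    finally show ?thesis .
  qed
  have BU': "((\<lambda>n. scov n (\<lambda>i. U i t) (\<lambda>i. B i $ k)) \<longlongrightarrow> 0) Fl" if "t < T" for k t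
    using BU[OF that] by (simp add: scov_commute)
  have eB: "((\<lambda>n. scov n (\<lambda>i. B i $ k) e) \<longlongrightarrow> 0) Fl" for k
    using tendsto_scov_null[OF ee BB[of k k]] by (simp add: scov_commute)
  have eU: "((\<lambda>n. scov n (\<lambda>i. U i t) e) \<longlongrightarrow> 0) Fl" if "t < T" for t
    using tendsto_scov_null[OF ee UU[OF that that]] by (simp add: scov_commute)
  have bb: "((\<lambda>n. scov n (\<lambda>i. ?b i $ k) (\<lambda>i. ?b i $ l)) \<longlongrightarrow> \<Gamma> $ k $ l) Fl" for k l
  proof -
    \<comment> \<open>The limit is written in the shape of the bilinear expansion so that it can be
      taken term by term; only errors of the same period contribute noise.\<close>
    have "((\<lambda>n. scov n (\<lambda>i. ?b i $ k) (\<lambda>i. ?b i $ l)) \<longlongrightarrow>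
        S $ k $ l + (\<Sum>t<T. ?W t $ l * 0) +
        (\<Sum>t<T. ?W t $ k * (0 + (\<Sum>s<T. ?W s $ l * (if t = s then \<sigma> else 0))))) Fl"
      unfolding bk
      by (simp only: scov_add_left scov_add_right scov_sum_left scov_sum_right finite_lessThan
          scov_cmult_left scov_cmult_right distrib_left sum.distrib add.assoc)
         (intro tendsto_intros BB BU BU' UU; simp)
    also have "S $ k $ l + (\<Sum>t<T. ?W t $ l * 0) +
        (\<Sum>t<T. ?W t $ k * (0 + (\<Sum>s<T. ?W s $ l * (if t = s then \<sigma> else 0))))
        = S $ k $ l + \<sigma> * (\<Sum>t<T. ?W t $ k * ?W t $ l)"
      by (simp add: if_distrib[of "\<lambda>x. _ * x"] sum.delta sum_distrib_left mult_ac cong: if_cong)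
    also have "\<dots> = \<Gamma> $ k $ l"
      using T by (simp add: \<Gamma>_def Sinv_eq sum_ols_weight_prod[OF invG])
    finally show ?thesis .
  qed
  have By: "((\<lambda>n. scov n (\<lambda>i. B i $ k) ?y) \<longlongrightarrow> (S *v lam) $ k) Fl" for k
  proof -
    have "((\<lambda>n. scov n (\<lambda>i. B i $ k) ?y) \<longlongrightarrow>
        0 + (\<Sum>l\<in>UNIV. lam $ l * S $ k $ l) + 0 + (\<Sum>t<T. (1 / real T) * 0)) Fl"
      unfolding y scov_add_right scov_sum_right[OF finite] scov_sum_right[OF finite_lessThan] scov_const_right scov_cmult_right
      by (intro tendsto_intros BB BU eB) simp
    then show ?thesis
      by (simp add: matrix_vector_mult_def mult.commute)
  qed
  \<comment> \<open>The error of period \<open>t\<close> itself enters the mean return with weight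
    \<open>1 / T\<close>, so this limit is not zero.\<close>
  have Uy: "((\<lambda>n. scov n (\<lambda>i. U i t) ?y) \<longlongrightarrow> \<sigma> / T) Fl" if t: "t < T" for t
  proof -
    have "((\<lambda>n. scov n (\<lambda>i. U i t) ?y) \<longlongrightarrow>
        0 + (\<Sum>l\<in>UNIV. lam $ l * 0) + 0 + (\<Sum>s<T. (1 / real T) * (if t = s then \<sigma> else 0))) Fl"
      unfolding y scov_add_right scov_sum_right[OF finite] scov_sum_right[OF finite_lessThan] scov_const_right scov_cmult_right
      by (intro tendsto_intros BU' UU eU t) simp
    then show ?thesis
      using t by (simp add: sum_divide_distrib[symmetric])
  qed
  have by': "((\<lambda>n. scov n (\<lambda>i. ?b i $ k) ?y) \<longlongrightarrow> (S *v lam) $ k) Fl" for k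
  proof -
    have "((\<lambda>n. scov n (\<lambda>i. ?b i $ k) ?y) \<longlongrightarrow> (S *v lam) $ k + (\<Sum>t<T. ?W t $ k * (\<sigma> / T))) Fl"
      unfolding bk scov_add_left scov_sum_left[OF finite_lessThan] scov_cmult_left
      by (intro tendsto_intros By Uy) simp
    \<comment> \<open>The noise limit is the same in every period, so it multiplies the sum of the
      weights and cancels.\<close>
    also have "(\<Sum>t<T. ?W t $ k * (\<sigma> / T)) = (\<sigma> / T) * (\<Sum>t<T. ?W t) $ k"
      by (simp add: sum_distrib_left mult.commute)
    finally show ?thesis
      by (simp add: sum_ols_weight)
  qed
  have n_pos: "\<forall>\<^sub>F n in Fl. 0 < n"
    using Fl(2) eventually_gt_at_top[of "0::nat"] by (rule filter_leD)
  define A where "A n = (\<chi> k l. scov n (\<lambda>i. ?b i $ k) (\<lambda>i. ?b i $ l))" for n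
  define z where "z n = (\<chi> k. scov n (\<lambda>i. ?b i $ k) ?y)" for n
  have A: "(A \<longlongrightarrow> \<Gamma>) Fl"
    unfolding A_def by (intro vec_tendstoI) (simp add: bb)
  have z: "(z \<longlongrightarrow> S *v lam) Fl"
    unfolding z_def by (intro vec_tendstoI) (simp add: by')
  have "((\<lambda>n. det (A n)) \<longlongrightarrow> det \<Gamma>) Fl"
    by (intro tendsto_det tendsto_intros A)
  then have "\<forall>\<^sub>F n in Fl. det (A n) \<noteq> 0"
    using inv\<Gamma> by (intro tendsto_imp_eventually_ne) (auto simp: invertible_det_nz)
  then have "\<forall>\<^sub>F n in Fl. matrix_inv (A n) *v z n = lambda_hat n T F r"
    using n_pos
  proof eventually_elim
    case (elim n)
    \<comment> \<open>The factor \<open>n\<close> in the Gram matrix cancels against the one in the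
      cross product, leaving the converging \<open>A n\<close> and \<open>z n\<close>.\<close>
    have "gram n ?b = real n *\<^sub>R A n" "cross n ?b ?y = real n *\<^sub>R z n"
      by (simp_all add: vec_eq_iff gram_nth cross_nth A_def z_def)
    moreover have "matrix_inv (real n *\<^sub>R A n) = (1 / real n) *\<^sub>R matrix_inv (A n)"
      using elim by (intro matrix_inv_scaleR) (auto simp: invertible_det_nz)
    ultimately show ?case
      using elim by (simp add: lambda_hat_def matrix_vector_mult_scaleR scaleR_matrix_vector_assoc[symmetric])
  qed
  moreover have "((\<lambda>n. matrix_inv (A n) *v z n) \<longlongrightarrow> matrix_inv \<Gamma> *v (S *v lam)) Fl"
    unfolding matrix_vector_mult_def[of "matrix_inv _"]
    by (intro tendsto_intros tendsto_matrix_inv[OF A inv\<Gamma>] z)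
  ultimately have "((\<lambda>n. lambda_hat n T F r) \<longlongrightarrow> matrix_inv \<Gamma> *v (S *v lam)) Fl"
    by (rule Lim_transform_eventually[rotated])
  \<comment> \<open>Replacing \<open>S\<close> by \<open>\<Gamma>\<close> minus its noise term
    separates the target \<open>lam\<close> from the attenuation bias.\<close>
  also have "S *v lam = \<Gamma> *v lam - (\<sigma> / real T) *\<^sub>R (Sinv *v lam)"
    by (simp add: \<Gamma>_def matrix_vector_mult_add_rdistrib scaleR_matrix_vector_assoc)
  also have "matrix_inv \<Gamma> *v \<dots> = lam - (\<sigma> / real T) *\<^sub>R (matrix_inv \<Gamma> *v (Sinv *v lam))"
    by (simp add: matrix_vector_mult_diff_distrib matrix_vector_mult_scaleR matrix_vector_mul_assoc[of _ \<Gamma>]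
        matrix_inv_left[OF inv\<Gamma>])
  finally show ?thesis
    by (simp add: \<Gamma>_def)
qed

section \<open>Convergence in probability\<close>

lemma conv_in_prob_subseq:
  "conv_in_prob M X L \<Longrightarrow> strict_mono r \<Longrightarrow> conv_in_prob M (\<lambda>n. X (r n)) L"
  unfolding conv_in_prob_def
  by (auto dest!: spec[where P="\<lambda>e. 0 < e \<longrightarrow> _ e"] dest: LIMSEQ_subseq_LIMSEQ[of _ _ r, unfolded o_def])

context prob_space
begin

text \<open>The expectation of the truncated norm metrizes convergence in probability to 0. It turns
  the notion into L1 convergence, where almost sure subsequences and dominated convergence are
  available.\<close>

lemma conv_in_prob_imp_min:
  fixes X :: "nat \<Rightarrow> 'a \<Rightarrow> 'b::{real_normed_vector, second_countable_topology}"
  assumes "conv_in_prob M X (\<lambda>_. 0)"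
  shows "(\<lambda>n. \<integral>\<omega>. min 1 (norm (X n \<omega>)) \<partial>M) \<longlonglongrightarrow> 0"
proof (rule LIMSEQ_I)
  fix e :: real assume e: "0 < e"
  have [measurable]: "X n \<in> borel_measurable M" for n
    using assms by (simp add: conv_in_prob_def)
  define A where "A n = {\<omega> \<in> space M. dist (X n \<omega>) 0 > e / 2}" for n
  have [measurable]: "A n \<in> events" for n
    by (simp add: A_def)
  have int: "integrable M (\<lambda>\<omega>. min 1 (norm (X n \<omega>)))" for n
    by (rule integrable_const_bound[of _ 1]) auto
  have "(\<lambda>n. prob (A n)) \<longlonglongrightarrow> 0"
    using assms half_gt_zero[OF e] unfolding conv_in_prob_def A_def by blast
  from LIMSEQ_D[OF this, of "e / 2"] e obtain N where N: "prob (A n) < e / 2" if "N \<le> n" for n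
    by auto
  \<comment> \<open>Off \<open>A n\<close> the integrand is at most \<open>e / 2\<close>, and on
    \<open>A n\<close> at most 1.\<close>
  have "(\<integral>\<omega>. min 1 (norm (X n \<omega>)) \<partial>M) \<le> (\<integral>\<omega>. e / 2 + indicator (A n) \<omega> \<partial>M)" for n
    using e
    by (intro integral_mono int Bochner_Integration.integrable_add integrable_const integrable_real_indicator)
       (auto simp: indicator_def emeasure_eq_measure A_def)
  also have "(\<integral>\<omega>. e / 2 + indicator (A n) \<omega> \<partial>M) = e / 2 + prob (A n)" for n
    by (subst Bochner_Integration.integral_add) (auto simp: prob_space emeasure_eq_measure)
  finally have *: "(\<integral>\<omega>. min 1 (norm (X n \<omega>)) \<partial>M) \<le> e / 2 + prob (A n)" for n .
  have "norm ((\<integral>\<omega>. min 1 (norm (X n \<omega>)) \<partial>M) - 0) < e" if "N \<le> n" for n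
  proof -
    have "0 \<le> (\<integral>\<omega>. min 1 (norm (X n \<omega>)) \<partial>M)"
      by (rule Bochner_Integration.integral_nonneg) simp
    then show ?thesis
      using * [of n] N[OF that] by simp
  qed
  then show "\<exists>N. \<forall>n\<ge>N. norm ((\<integral>\<omega>. min 1 (norm (X n \<omega>)) \<partial>M) - 0) < e"
    by blast
qed

lemma conv_in_probI_min:
  fixes X :: "nat \<Rightarrow> 'a \<Rightarrow> 'b::{real_normed_vector, second_countable_topology}"
  assumes [measurable]: "\<And>n. X n \<in> borel_measurable M"
    and lim: "(\<lambda>n. \<integral>\<omega>. min 1 (norm (X n \<omega>)) \<partial>M) \<longlonglongrightarrow> 0"
  shows "conv_in_prob M X (\<lambda>_. 0)"
  unfolding conv_in_prob_def
proof (intro conjI allI impI)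
  fix e :: real assume e: "0 < e"
  have int: "integrable M (\<lambda>\<omega>. min 1 (norm (X n \<omega>)))" for n
    by (rule integrable_const_bound[of _ 1]) auto
  \<comment> \<open>The truncated norm never exceeds 1, so the threshold for Markov's inequality is
    \<open>min 1 e\<close> rather than \<open>e\<close>.\<close>
  have "prob {\<omega> \<in> space M. e < dist (X n \<omega>) 0} \<le> prob {\<omega> \<in> space M. min 1 e \<le> min 1 (norm (X n \<omega>))}" for n
    by (rule finite_measure_mono) auto
  also have "prob {\<omega> \<in> space M. min 1 e \<le> min 1 (norm (X n \<omega>))} \<le> (\<integral>\<omega>. min 1 (norm (X n \<omega>)) \<partial>M) / min 1 e" for n
    using e by (intro integral_Markov_inequality_measure[where A="{}"] int) auto
  finally have le: "prob {\<omega> \<in> space M. e < dist (X n \<omega>) 0} \<le> (\<integral>\<omega>. min 1 (norm (X n \<omega>)) \<partial>M) / min 1 e" for n .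
  show "(\<lambda>n. prob {\<omega> \<in> space M. e < dist (X n \<omega>) 0}) \<longlonglongrightarrow> 0"
    by (rule tendsto_sandwich[OF _ _ tendsto_const tendsto_divide_zero[OF lim, of "min 1 e"]])
       (intro always_eventually allI measure_nonneg le)+
qed auto

text \<open>Induction over the finite set: each new sequence is thinned along the subsequence
  already found, and thinning further preserves the earlier almost sure limits.\<close>

lemma conv_in_prob_AE_subseq:
  fixes S :: "(nat \<Rightarrow> 'a \<Rightarrow> real) set"
  assumes "finite S" "\<And>X. X \<in> S \<Longrightarrow> conv_in_prob M X (\<lambda>_. 0)"
  shows "\<exists>r::nat \<Rightarrow> nat. strict_mono r \<and> (AE \<omega> in M. \<forall>X\<in>S. (\<lambda>n. X (r n) \<omega>) \<longlonglongrightarrow> 0)"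
  using assms
proof (induction S rule: finite_induct)
  case empty
  show ?case
    by (rule exI[of _ id]) (simp add: strict_mono_def)
next
  case (insert X S)
  then obtain r :: "nat \<Rightarrow> nat" where r: "strict_mono r"
    and S: "AE \<omega> in M. \<forall>X\<in>S. (\<lambda>n. X (r n) \<omega>) \<longlonglongrightarrow> 0"
    by auto
  have X: "conv_in_prob M (\<lambda>n. X (r n)) (\<lambda>_. 0)"
    using insert.prems r by (simp add: conv_in_prob_subseq)
  then have [measurable]: "X (r n) \<in> borel_measurable M" for n
    by (simp add: conv_in_prob_def)
  have "\<exists>s::nat \<Rightarrow> nat. strict_mono s \<and> (AE \<omega> in M. (\<lambda>n. min 1 \<bar>X (r (s n)) \<omega>\<bar>) \<longlonglongrightarrow> 0)"
  proof (rule tendsto_L1_AE_subseq)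
    show "integrable M (\<lambda>\<omega>. min 1 \<bar>X (r n) \<omega>\<bar>)" for n
      by (rule integrable_const_bound[of _ 1]) auto
    show "(\<lambda>n. \<integral>\<omega>. norm (min 1 \<bar>X (r n) \<omega>\<bar>) \<partial>M) \<longlonglongrightarrow> 0"
      using conv_in_prob_imp_min[OF X] by simp
  qed
  then obtain s :: "nat \<Rightarrow> nat" where s: "strict_mono s"
    and X': "AE \<omega> in M. (\<lambda>n. min 1 \<bar>X (r (s n)) \<omega>\<bar>) \<longlonglongrightarrow> 0"
    by blast
  have "(\<lambda>n. X (r (s n)) \<omega>) \<longlonglongrightarrow> 0" if "(\<lambda>n. min 1 \<bar>X (r (s n)) \<omega>\<bar>) \<longlonglongrightarrow> 0" for \<omega>
  proof (rule Lim_null_comparison[OF _ that])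
    \<comment> \<open>Once the truncated value is below 1 the truncation is inactive, so the
      untruncated sequence has the same limit.\<close>
    have "\<forall>\<^sub>F n in sequentially. min 1 \<bar>X (r (s n)) \<omega>\<bar> < 1"
      using that by (rule order_tendstoD) simp
    then show "\<forall>\<^sub>F n in sequentially. norm (X (r (s n)) \<omega>) \<le> min 1 \<bar>X (r (s n)) \<omega>\<bar>"
      by eventually_elim auto
  qed
  with X' S have "AE \<omega> in M. \<forall>X\<in>insert X S. (\<lambda>n. X ((r \<circ> s) n) \<omega>) \<longlonglongrightarrow> 0"
    by (auto elim!: eventually_elim2 dest!: bspec dest: LIMSEQ_subseq_LIMSEQ[OF _ s, unfolded o_def])
  then show ?case
    using strict_mono_o[OF r s] by blast
qed

text \<open>The subsequence principle. If the truncated expectations stayed away from 0 along some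
  \<open>r\<close>, a further subsequence would make all of \<open>S\<close> converge almost surely,
  hence \<open>Z\<close> too, and dominated convergence with bound 1 would contradict this. The
  subsequences are quantified inside \<open>AE\<close>, so what is left to prove concerns one path
  at a time.\<close>

lemma conv_in_prob_subseqI:
  fixes Z :: "nat \<Rightarrow> 'a \<Rightarrow> 'b::{real_normed_vector, second_countable_topology}"
  assumes fin: "finite S" and S: "\<And>X. X \<in> S \<Longrightarrow> conv_in_prob M X (\<lambda>_. 0 :: real)"
    and [measurable]: "\<And>n. Z n \<in> borel_measurable M"
    and lim: "AE \<omega> in M. \<forall>r::nat \<Rightarrow> nat. strict_mono r \<longrightarrow> (\<forall>X\<in>S. (\<lambda>n. X (r n) \<omega>) \<longlonglongrightarrow> 0) \<longrightarrow>
      (\<lambda>n. Z (r n) \<omega>) \<longlonglongrightarrow> 0"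
  shows "conv_in_prob M Z (\<lambda>_. 0)"
proof (rule conv_in_probI_min)
  let ?E = "\<lambda>n. \<integral>\<omega>. min 1 (norm (Z n \<omega>)) \<partial>M"
  show "?E \<longlonglongrightarrow> 0"
  proof (rule ccontr)
    assume "\<not> ?E \<longlonglongrightarrow> 0"
    then obtain e where e: "0 < e" "\<not> (\<forall>\<^sub>F n in sequentially. dist (?E n) 0 < e)"
      by (auto simp: tendsto_iff)
    from not_eventually_sequentiallyD[OF this(2)]
    obtain r :: "nat \<Rightarrow> nat" where r: "strict_mono r" "\<And>n. \<not> dist (?E (r n)) 0 < e"
      by blast
    have "\<exists>s::nat \<Rightarrow> nat. strict_mono s \<and>
        (AE \<omega> in M. \<forall>X\<in>(\<lambda>X n. X (r n)) ` S. (\<lambda>n. X (s n) \<omega>) \<longlonglongrightarrow> 0)"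
      using fin S r(1) by (intro conv_in_prob_AE_subseq) (auto intro: conv_in_prob_subseq)
    then obtain s :: "nat \<Rightarrow> nat" where s: "strict_mono s"
      and "AE \<omega> in M. \<forall>X\<in>(\<lambda>X n. X (r n)) ` S. (\<lambda>n. X (s n) \<omega>) \<longlonglongrightarrow> 0"
      by blast
    from this(2) lim have Z: "AE \<omega> in M. (\<lambda>n. Z (r (s n)) \<omega>) \<longlonglongrightarrow> 0"
    proof eventually_elim
      case (elim \<omega>)
      then show ?case
        using strict_mono_compose[OF r(1) s] by (auto dest!: spec[of _ "\<lambda>n. r (s n)"])
    qed
    have "(\<lambda>n. ?E (r (s n))) \<longlonglongrightarrow> (\<integral>\<omega>. 0 \<partial>M)"
    proof (rule integral_dominated_convergence[where w="\<lambda>_. 1"])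
      show "AE \<omega> in M. (\<lambda>n. min 1 (norm (Z (r (s n)) \<omega>))) \<longlonglongrightarrow> 0"
        using Z
      proof eventually_elim
        case (elim \<omega>)
        have "(\<lambda>n. min 1 (norm (Z (r (s n)) \<omega>))) \<longlonglongrightarrow> min 1 (norm (0 :: 'b))"
          by (intro tendsto_intros elim)
        then show ?case by simp
      qed
    qed auto
    then have "\<forall>\<^sub>F n in sequentially. dist (?E (r (s n))) 0 < e"
      using e(1) by (auto dest: tendstoD)
    then show False
      using r(2) by auto
  qed
qed fact

section \<open>Second-moment bounds and independence\<close>

lemma integrable_mult_if_squares:
  fixes X Y :: "'a \<Rightarrow> real"
  assumes [measurable]: "X \<in> borel_measurable M" "Y \<in> borel_measurable M"
    and "integrable M (\<lambda>\<omega>. (X \<omega>)\<^sup>2)" "integrable M (\<lambda>\<omega>. (Y \<omega>)\<^sup>2)"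
  shows "integrable M (\<lambda>\<omega>. X \<omega> * Y \<omega>)"
proof (rule Bochner_Integration.integrable_bound)
  show "integrable M (\<lambda>\<omega>. (X \<omega>)\<^sup>2 + (Y \<omega>)\<^sup>2)"
    using assms by simp
  have "\<bar>x * y\<bar> \<le> \<bar>x\<^sup>2 + y\<^sup>2\<bar>" for x y :: real
  proof -
    have "2 * (\<bar>x\<bar> * \<bar>y\<bar>) \<le> x\<^sup>2 + y\<^sup>2" and "0 \<le> \<bar>x\<bar> * \<bar>y\<bar>"
      using sum_squares_bound[of "\<bar>x\<bar>" "\<bar>y\<bar>"] by (auto simp: mult.assoc)
    then show ?thesis
      unfolding abs_mult by linarith
  qed
  then show "AE \<omega> in M. norm (X \<omega> * Y \<omega>) \<le> norm ((X \<omega>)\<^sup>2 + (Y \<omega>)\<^sup>2)"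
    by simp
qed simp

text \<open>Chebyshev's inequality: bounded row sums of the second-moment matrix make the mean
  square of the average at most \<open>C / n\<close>. The array form \<open>X n i\<close> admits
  weights that depend on the sample size, such as centred loadings.\<close>

lemma conv_in_prob_avg_zero:
  fixes X :: "nat \<Rightarrow> nat \<Rightarrow> 'a \<Rightarrow> real"
  assumes [measurable]: "\<And>n i. X n i \<in> borel_measurable M"
    and sq: "\<And>n i. integrable M (\<lambda>\<omega>. (X n i \<omega>)\<^sup>2)"
    and bound: "\<And>n i. i < n \<Longrightarrow> (\<Sum>j<n. expectation (\<lambda>\<omega>. X n i \<omega> * X n j \<omega>)) \<le> C"
  shows "conv_in_prob M (\<lambda>n \<omega>. avg n (\<lambda>i. X n i \<omega>)) (\<lambda>_. 0)"
  unfolding conv_in_prob_def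
proof (intro conjI allI impI)
  let ?Y = "\<lambda>n \<omega>. avg n (\<lambda>i. X n i \<omega>)"
  show meas[measurable]: "?Y n \<in> borel_measurable M" for n
    by (simp add: avg_def)
  have prod: "integrable M (\<lambda>\<omega>. X n i \<omega> * X n j \<omega>)" for n i j
    by (intro integrable_mult_if_squares sq) auto
  have eq: "(?Y n \<omega>)\<^sup>2 = (1 / real n)\<^sup>2 * (\<Sum>i<n. \<Sum>j<n. X n i \<omega> * X n j \<omega>)" for n \<omega>
    by (simp add: avg_def power2_eq_square sum_product)
  have int: "integrable M (\<lambda>\<omega>. (?Y n \<omega>)\<^sup>2)" for n
    unfolding eq by (intro integrable_mult_right Bochner_Integration.integrable_sum prod)
  have E: "expectation (\<lambda>\<omega>. (?Y n \<omega>)\<^sup>2) \<le> C / real n" for n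
  proof -
    have "expectation (\<lambda>\<omega>. (?Y n \<omega>)\<^sup>2) = (1 / real n)\<^sup>2 * (\<Sum>i<n. \<Sum>j<n. expectation (\<lambda>\<omega>. X n i \<omega> * X n j \<omega>))"
      unfolding eq by (simp add: prod)
    also have "\<dots> \<le> (1 / real n)\<^sup>2 * (\<Sum>i<n. C)"
      by (intro mult_left_mono sum_mono bound) auto
    finally show ?thesis
      by (simp add: power2_eq_square field_simps split: if_splits)
  qed
  fix e :: real assume e: "0 < e"
  have "prob {\<omega> \<in> space M. e < dist (?Y n \<omega>) 0} \<le> prob {\<omega> \<in> space M. e\<^sup>2 \<le> (?Y n \<omega>)\<^sup>2}" for n
    using e by (intro finite_measure_mono) (auto simp: abs_le_square_iff[symmetric])
  also have "prob {\<omega> \<in> space M. e\<^sup>2 \<le> (?Y n \<omega>)\<^sup>2} \<le> expectation (\<lambda>\<omega>. (?Y n \<omega>)\<^sup>2) / e\<^sup>2" for n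
    using e by (intro integral_Markov_inequality_measure[where A="{}"] int) auto
  also have "expectation (\<lambda>\<omega>. (?Y n \<omega>)\<^sup>2) / e\<^sup>2 \<le> C / real n / e\<^sup>2" for n
    by (intro divide_right_mono E) auto
  finally have le: "prob {\<omega> \<in> space M. e < dist (?Y n \<omega>) 0} \<le> C / real n / e\<^sup>2" for n .
  have lim: "(\<lambda>n. C / real n / e\<^sup>2) \<longlonglongrightarrow> 0"
    by (intro tendsto_divide_zero lim_const_over_n)
  show "(\<lambda>n. prob {\<omega> \<in> space M. e < dist (?Y n \<omega>) 0}) \<longlonglongrightarrow> 0"
    by (rule tendsto_sandwich[OF _ _ tendsto_const lim]) (rule always_eventually, rule allI, rule measure_nonneg le)+
qed auto

text \<open>Composition only shrinks the generated sigma-algebras, so independence is inherited.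
  With both images in one type, the product rules for \<open>indep_var\<close> apply.\<close>

lemma indep_rv_compose:
  assumes "indep_rv M S X N Y" "h \<in> measurable S (S' :: 'b measure)" "k \<in> measurable N (N' :: 'b measure)"
  shows "indep_var S' (\<lambda>\<omega>. h (X \<omega>)) N' (\<lambda>\<omega>. k (Y \<omega>))"
proof -
  let ?A = "vimage_algebra (space M) X S" and ?B = "vimage_algebra (space M) Y N"
  have X: "X \<in> measurable M S" and Y: "Y \<in> measurable M N" and ind: "indep_set (sets ?A) (sets ?B)"
    using assms(1) by (simp_all add: indep_rv_def)
  have "X \<in> measurable ?A S" "Y \<in> measurable ?B N"
    using measurable_space[OF X] measurable_space[OF Y] by (auto intro: measurable_vimage_algebra1)
  then have "(\<lambda>\<omega>. h (X \<omega>)) \<in> measurable ?A S'" "(\<lambda>\<omega>. k (Y \<omega>)) \<in> measurable ?B N'"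
    using assms(2,3) by (auto intro: measurable_compose)
  then have "sets (vimage_algebra (space M) (\<lambda>\<omega>. h (X \<omega>)) S') \<subseteq> sets ?A"
    "sets (vimage_algebra (space M) (\<lambda>\<omega>. k (Y \<omega>)) N') \<subseteq> sets ?B"
    by (auto intro!: sets_image_in_sets del: subsetI)
  then have "indep_set (sets (vimage_algebra (space M) (\<lambda>\<omega>. h (X \<omega>)) S'))
      (sets (vimage_algebra (space M) (\<lambda>\<omega>. k (Y \<omega>)) N'))"
    using ind unfolding indep_sets2_eq by blast
  then show ?thesis
    using measurable_compose[OF X assms(2)] measurable_compose[OF Y assms(3)]
    by (simp add: indep_var_eq sets_vimage_algebra)
qed

end

section \<open>Measurability\<close>

lemma borel_measurable_vecI:
  fixes f :: "'w \<Rightarrow> real ^ 'k"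
  assumes "\<And>k. (\<lambda>\<omega>. f \<omega> $ k) \<in> borel_measurable M"
  shows "f \<in> borel_measurable M"
  using assms by (subst borel_measurable_euclidean_space) (auto simp: Basis_vec_def inner_axis)

lemma borel_measurable_matrixI:
  fixes f :: "'w \<Rightarrow> real ^ 'k ^ 'k"
  assumes "\<And>k l. (\<lambda>\<omega>. f \<omega> $ k $ l) \<in> borel_measurable M"
  shows "f \<in> borel_measurable M"
  using assms
  by (subst borel_measurable_euclidean_space) (auto simp: Basis_vec_def inner_axis borel_measurable_vecI)

lemma borel_measurable_vec_nth [measurable (raw)]:
  fixes f :: "'w \<Rightarrow> 'b::{real_normed_vector} ^ 'k"
  assumes "f \<in> borel_measurable M"
  shows "(\<lambda>\<omega>. f \<omega> $ k) \<in> borel_measurable M"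
proof -
  have "(\<lambda>x :: 'b ^ 'k. x $ k) \<in> borel_measurable borel"
    by (intro borel_measurable_continuous_onI continuous_intros)
  from measurable_compose[OF assms this] show ?thesis .
qed

lemma borel_measurable_det:
  fixes A :: "'w \<Rightarrow> real ^ 'k ^ 'k"
  assumes "\<And>i j. (\<lambda>\<omega>. A \<omega> $ i $ j) \<in> borel_measurable M"
  shows "(\<lambda>\<omega>. det (A \<omega>)) \<in> borel_measurable M"
  unfolding det_def
  by (intro borel_measurable_sum borel_measurable_times borel_measurable_const borel_measurable_prod assms)

text \<open>For a singular matrix the predicate under the choice operator is empty, so
  \<open>matrix_inv\<close> returns one and the same default value.\<close>

lemma matrix_inv_singular:
  fixes A B :: "real ^ 'k ^ 'k"
  assumes "det A = 0" "det B = 0"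
  shows "matrix_inv A = matrix_inv B"
proof -
  have "\<not> invertible A" "\<not> invertible B"
    using assms by (auto simp: invertible_det_nz)
  then show ?thesis
    by (auto simp: matrix_inv_def invertible_def intro!: arg_cong[of _ _ Eps])
qed

lemma borel_measurable_matrix_inv [measurable (raw)]:
  fixes A :: "'w \<Rightarrow> real ^ 'k ^ 'k"
  assumes [measurable]: "A \<in> borel_measurable M"
  shows "(\<lambda>\<omega>. matrix_inv (A \<omega>)) \<in> borel_measurable M"
proof (rule borel_measurable_matrixI)
  fix k l
  let ?N = "\<lambda>\<omega>. \<chi> i j. if j = k then axis l 1 $ i else A \<omega> $ i $ j"
  have [measurable]: "(\<lambda>\<omega>. det (A \<omega>)) \<in> borel_measurable M" "(\<lambda>\<omega>. det (?N \<omega>)) \<in> borel_measurable M"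
    by (intro borel_measurable_det; simp)+
  \<comment> \<open>On the event of a zero determinant the inverse is the constant default,
    represented by \<open>matrix_inv 0\<close>; elsewhere Cramer's rule applies.\<close>
  have "(\<lambda>\<omega>. matrix_inv (A \<omega>) $ k $ l)
      = (\<lambda>\<omega>. if det (A \<omega>) = 0 then matrix_inv 0 $ k $ l else det (?N \<omega>) / det (A \<omega>))"
    by (auto simp: fun_eq_iff matrix_inv_cramer intro!: arg_cong[of _ _ "\<lambda>B. B $ k $ l"] matrix_inv_singular)
       (simp flip: mat_0)
  then show "(\<lambda>\<omega>. matrix_inv (A \<omega>) $ k $ l) \<in> borel_measurable M"
    by simp
qed

lemma borel_measurable_matrix_vector_mult [measurable (raw)]:
  fixes A :: "'w \<Rightarrow> real ^ 'k ^ 'k"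
  assumes [measurable]: "A \<in> borel_measurable M" "x \<in> borel_measurable M"
  shows "(\<lambda>\<omega>. A \<omega> *v x \<omega>) \<in> borel_measurable M"
  by (rule borel_measurable_vecI) (simp add: matrix_vector_mult_def)

lemma borel_measurable_avg [measurable (raw)]:
  fixes X :: "nat \<Rightarrow> 'w \<Rightarrow> 'b::{second_countable_topology, real_normed_vector}"
  assumes [measurable]: "\<And>s. X s \<in> borel_measurable M"
  shows "(\<lambda>\<omega>. avg m (\<lambda>s. X s \<omega>)) \<in> borel_measurable M"
  by (simp add: avg_def)

lemma borel_measurable_scov [measurable (raw)]:
  assumes [measurable]: "\<And>s. X s \<in> borel_measurable M" "\<And>s. Y s \<in> borel_measurable M"
  shows "(\<lambda>\<omega>. scov m (\<lambda>s. X s \<omega>) (\<lambda>s. Y s \<omega>)) \<in> borel_measurable M"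
  by (simp add: scov_def)

lemma borel_measurable_gram [measurable (raw)]:
  fixes X :: "nat \<Rightarrow> 'w \<Rightarrow> real ^ 'k"
  assumes [measurable]: "\<And>s. X s \<in> borel_measurable M"
  shows "(\<lambda>\<omega>. gram m (\<lambda>s. X s \<omega>)) \<in> borel_measurable M"
  by (rule borel_measurable_matrixI) (simp add: gram_nth)

lemma borel_measurable_cross [measurable (raw)]:
  fixes X :: "nat \<Rightarrow> 'w \<Rightarrow> real ^ 'k"
  assumes [measurable]: "\<And>s. X s \<in> borel_measurable M" "\<And>s. y s \<in> borel_measurable M"
  shows "(\<lambda>\<omega>. cross m (\<lambda>s. X s \<omega>) (\<lambda>s. y s \<omega>)) \<in> borel_measurable M"
  by (rule borel_measurable_vecI) (simp add: cross_nth)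

lemma borel_measurable_lambda_hat [measurable (raw)]:
  fixes f :: "nat \<Rightarrow> 'w \<Rightarrow> real ^ 'k"
  assumes [measurable]: "\<And>t. f t \<in> borel_measurable M" "\<And>i t. r i t \<in> borel_measurable M"
  shows "(\<lambda>\<omega>. lambda_hat n T (\<lambda>t. f t \<omega>) (\<lambda>i t. r i t \<omega>)) \<in> borel_measurable M"
proof -
  have [measurable]: "(\<lambda>\<omega>. beta_hat T (\<lambda>t. f t \<omega>) (\<lambda>i t. r i t \<omega>) i) \<in> borel_measurable M" for i
    unfolding beta_hat_def by measurable
  show ?thesis
    unfolding lambda_hat_def by measurable
qed

section \<open>Idiosyncratic errors\<close>

text \<open>\<open>Z\<close> collects all random elements that are independent of the errors.\<close>

locale idiosyncratic_errors = prob_space M for M :: "'a measure" +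
  fixes v :: "nat \<Rightarrow> nat \<Rightarrow> 'a \<Rightarrow> real" and \<sigma>v :: "nat \<Rightarrow> nat \<Rightarrow> real" and C :: real
    and N :: "'z measure" and Z :: "'a \<Rightarrow> 'z"
  assumes indep: "indep_rv M (\<Pi>\<^sub>M p \<in> UNIV. borel) (\<lambda>\<omega> (i, t). v i t \<omega>) N Z"
    and serial: "indep_vars (\<lambda>_. \<Pi>\<^sub>M i \<in> UNIV. borel) (\<lambda>t \<omega> i. v i t \<omega>) UNIV"
    and mean: "expectation (v i t) = 0"
    and fourth: "integrable M (\<lambda>\<omega>. v i t \<omega> ^ 4)"
    and second: "expectation (\<lambda>\<omega>. v i t \<omega> * v j t \<omega>) = \<sigma>v i j"
    and row_sum: "i < n \<Longrightarrow> (\<Sum>j<n. \<bar>\<sigma>v i j\<bar>) \<le> C"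
    and cov_row_sum: "\<exists>C'. \<forall>n. \<forall>i<n. (\<Sum>j<n. cov M (\<lambda>\<omega>. (v i t \<omega>)\<^sup>2) (\<lambda>\<omega>. (v j t \<omega>)\<^sup>2)) \<le> C'"
begin

lemma Z_measurable [measurable]: "Z \<in> measurable M N"
  using indep by (simp add: indep_rv_def)

lemma v_measurable [measurable]: "v i t \<in> borel_measurable M"
proof -
  have "(\<lambda>\<omega> (i, t). v i t \<omega>) \<in> measurable M (\<Pi>\<^sub>M p \<in> UNIV. borel)"
    using indep by (simp add: indep_rv_def)
  from measurable_compose[OF this measurable_component_singleton[of "(i, t)"]] show ?thesis
    by simp
qed

lemma v_square_integrable: "integrable M (\<lambda>\<omega>. (v i t \<omega>)\<^sup>2)"
proof (rule Bochner_Integration.integrable_bound)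
  show "integrable M (\<lambda>\<omega>. 1 + v i t \<omega> ^ 4)"
    using fourth by simp
  have "x\<^sup>2 \<le> 1 + x ^ 4" for x :: real
  proof -
    have "0 \<le> (x\<^sup>2 - 1)\<^sup>2"
      by simp
    then have "2 * x\<^sup>2 \<le> x ^ 4 + 1"
      by (simp add: power2_diff power_mult[symmetric])
    then show ?thesis
      using zero_le_power2[of x] by linarith
  qed
  then show "AE \<omega> in M. norm ((v i t \<omega>)\<^sup>2) \<le> norm (1 + v i t \<omega> ^ 4)"
    by simp
qed simp

lemma v_integrable: "integrable M (v i t)"
  using integrable_mult_if_squares[of "v i t" "\<lambda>_. 1"] v_square_integrable by simp

lemma v_mult_integrable: "integrable M (\<lambda>\<omega>. v i s \<omega> * v j t \<omega>)"
  by (intro integrable_mult_if_squares v_square_integrable) auto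

lemma C_nonneg: "0 \<le> C"
  using row_sum[of 0 1] by simp

lemma abs_cov_le: "\<bar>\<sigma>v i j\<bar> \<le> C"
proof -
  \<comment> \<open>The length \<open>Suc (max i j)\<close> contains column \<open>j\<close> and
    also satisfies the condition on \<open>i\<close> in \<open>row_sum\<close>.\<close>
  have "\<bar>\<sigma>v i j\<bar> \<le> (\<Sum>j<Suc (max i j). \<bar>\<sigma>v i j\<bar>)"
    by (rule member_le_sum) auto
  also have "\<dots> \<le> C"
    by (rule row_sum) auto
  finally show ?thesis .
qed

lemma indep_Z_v2:
  assumes "h \<in> borel_measurable N"
  shows "indep_var borel (\<lambda>\<omega>. v i s \<omega> * v j t \<omega>) borel (\<lambda>\<omega>. h (Z \<omega>))"
  using indep_rv_compose[OF indep _ assms, of "\<lambda>x. x (i, s) * x (j, t)" borel] by simp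

lemma indep_Z_v:
  assumes "h \<in> borel_measurable N"
  shows "indep_var borel (v i t) borel (\<lambda>\<omega>. h (Z \<omega>))"
  using indep_rv_compose[OF indep _ assms, of "\<lambda>x. x (i, t)" borel] by simp

lemma conv_in_prob_avg_v: "conv_in_prob M (\<lambda>n \<omega>. avg n (\<lambda>i. v i t \<omega>)) (\<lambda>_. 0)"
proof (rule conv_in_prob_avg_zero)
  fix n i :: nat assume "i < n"
  have "(\<Sum>j<n. \<sigma>v i j) \<le> (\<Sum>j<n. \<bar>\<sigma>v i j\<bar>)"
    by (intro sum_mono) simp
  also have "\<dots> \<le> C"
    using \<open>i < n\<close> by (rule row_sum)
  finally show "(\<Sum>j<n. expectation (\<lambda>\<omega>. v i t \<omega> * v j t \<omega>)) \<le> C"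
    by (simp add: second)
qed (auto intro: v_square_integrable)

text \<open>Independence factors each second moment into \<open>\<sigma>v i j\<close> times a moment
  of the weights, which is at most \<open>D\<close> in absolute value since
  \<open>2 * \<bar>x * y\<bar> \<le> x\<^sup>2 + y\<^sup>2\<close>. Row sums are therefore at most
  \<open>C * D\<close>.\<close>

lemma conv_in_prob_avg_v_weighted:
  assumes h[measurable]: "\<And>n i. h n i \<in> borel_measurable N"
    and sq: "\<And>n i. integrable M (\<lambda>\<omega>. (h n i (Z \<omega>))\<^sup>2)"
    and D: "\<And>n i. expectation (\<lambda>\<omega>. (h n i (Z \<omega>))\<^sup>2) \<le> D"
  shows "conv_in_prob M (\<lambda>n \<omega>. avg n (\<lambda>i. h n i (Z \<omega>) * v i t \<omega>)) (\<lambda>_. 0)"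
proof (rule conv_in_prob_avg_zero)
  show "integrable M (\<lambda>\<omega>. (h n i (Z \<omega>) * v i t \<omega>)\<^sup>2)" for n i
    using indep_var_integrable[OF indep_Z_v2[of "\<lambda>z. (h n i z)\<^sup>2" i t i t]] v_square_integrable sq
    by (simp add: power_mult_distrib power2_eq_square mult_ac)
  fix n i :: nat assume i: "i < n"
  have int: "integrable M (\<lambda>\<omega>. h n i (Z \<omega>) * h n j (Z \<omega>))" for j
    by (intro integrable_mult_if_squares sq) auto
  have "expectation (\<lambda>\<omega>. h n i (Z \<omega>) * v i t \<omega> * (h n j (Z \<omega>) * v j t \<omega>)) \<le> \<bar>\<sigma>v i j\<bar> * D" for j
  proof -
    have "\<bar>expectation (\<lambda>\<omega>. h n i (Z \<omega>) * h n j (Z \<omega>))\<bar> \<le> expectation (\<lambda>\<omega>. \<bar>h n i (Z \<omega>) * h n j (Z \<omega>)\<bar>)"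
      by (rule integral_abs_bound)
    also have "\<dots> \<le> expectation (\<lambda>\<omega>. ((h n i (Z \<omega>))\<^sup>2 + (h n j (Z \<omega>))\<^sup>2) / 2)"
    proof (rule integral_mono)
      show "\<bar>h n i (Z \<omega>) * h n j (Z \<omega>)\<bar> \<le> ((h n i (Z \<omega>))\<^sup>2 + (h n j (Z \<omega>))\<^sup>2) / 2" for \<omega>
        using sum_squares_bound[of "\<bar>h n i (Z \<omega>)\<bar>" "\<bar>h n j (Z \<omega>)\<bar>"] by (simp add: abs_mult)
    qed (use int sq in auto)
    also have "\<dots> \<le> D"
      using D[of n i] D[of n j] sq by simp
    finally have "\<bar>\<sigma>v i j * expectation (\<lambda>\<omega>. h n i (Z \<omega>) * h n j (Z \<omega>))\<bar> \<le> \<bar>\<sigma>v i j\<bar> * D"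
      unfolding abs_mult by (rule mult_left_mono) simp
    moreover have "expectation (\<lambda>\<omega>. v i t \<omega> * v j t \<omega> * (h n i (Z \<omega>) * h n j (Z \<omega>)))
        = \<sigma>v i j * expectation (\<lambda>\<omega>. h n i (Z \<omega>) * h n j (Z \<omega>))"
      using indep_var_lebesgue_integral[OF indep_Z_v2[of "\<lambda>z. h n i z * h n j z" i t j t]] v_mult_integrable int
      by (simp add: second)
    ultimately show ?thesis
      by (simp add: mult_ac)
  qed
  then have "(\<Sum>j<n. expectation (\<lambda>\<omega>. h n i (Z \<omega>) * v i t \<omega> * (h n j (Z \<omega>) * v j t \<omega>))) \<le> (\<Sum>j<n. \<bar>\<sigma>v i j\<bar>) * D"
    unfolding sum_distrib_right by (intro sum_mono)
  also have "0 \<le> D"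
    using order_trans[OF Bochner_Integration.integral_nonneg D[of n i]] by simp
  then have "(\<Sum>j<n. \<bar>\<sigma>v i j\<bar>) * D \<le> C * D"
    by (intro mult_right_mono row_sum i)
  finally show "(\<Sum>j<n. expectation (\<lambda>\<omega>. h n i (Z \<omega>) * v i t \<omega> * (h n j (Z \<omega>) * v j t \<omega>))) \<le> C * D" .
qed measurable

text \<open>The second moments of the centred squares are the covariances bounded in
  \<open>cov_row_sum\<close>, and fourth moments make them square integrable.\<close>

lemma conv_in_prob_avg_v_square: "conv_in_prob M (\<lambda>n \<omega>. avg n (\<lambda>i. (v i t \<omega>)\<^sup>2 - \<sigma>v i i)) (\<lambda>_. 0)"
proof -
  obtain C' where C': "\<And>n i. i < n \<Longrightarrow> (\<Sum>j<n. cov M (\<lambda>\<omega>. (v i t \<omega>)\<^sup>2) (\<lambda>\<omega>. (v j t \<omega>)\<^sup>2)) \<le> C'"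
    using cov_row_sum by blast
  have E: "expectation (\<lambda>\<omega>. (v i t \<omega>)\<^sup>2) = \<sigma>v i i" for i
    using second[of i t i] by (simp add: power2_eq_square)
  show ?thesis
  proof (rule conv_in_prob_avg_zero)
    show "(\<Sum>j<n. expectation (\<lambda>\<omega>. ((v i t \<omega>)\<^sup>2 - \<sigma>v i i) * ((v j t \<omega>)\<^sup>2 - \<sigma>v j j))) \<le> C'"
      if "i < n" for n i
      using C'[OF that] by (simp add: cov_def E)
    show "integrable M (\<lambda>\<omega>. ((v i t \<omega>)\<^sup>2 - \<sigma>v i i)\<^sup>2)" for i
      using fourth[of i t] v_square_integrable[of i t]
      by (simp add: power2_diff power_mult[symmetric] mult.assoc)
  qed simp
qed

text \<open>Whole cross sections of different periods are independent, so the second moments factor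
  into \<open>\<sigma>v i j * \<sigma>v i j\<close>. Bounding one factor by \<open>C\<close> reduces
  this to the row sums.\<close>

lemma conv_in_prob_avg_v_cross:
  assumes "s \<noteq> t"
  shows "conv_in_prob M (\<lambda>n \<omega>. avg n (\<lambda>i. v i s \<omega> * v i t \<omega>)) (\<lambda>_. 0)"
proof (rule conv_in_prob_avg_zero)
  have v2: "indep_var borel (\<lambda>\<omega>. v i s \<omega> * v j s \<omega>) borel (\<lambda>\<omega>. v i t \<omega> * v j t \<omega>)" for i j
  proof -
    have "(\<lambda>x. x t i :: real) \<in> borel_measurable (\<Pi>\<^sub>M t \<in> {t}. (\<Pi>\<^sub>M i \<in> UNIV. borel))" for t i :: nat
      by (rule measurable_compose[of "\<lambda>x. x t" _ "\<Pi>\<^sub>M i \<in> UNIV. borel" "\<lambda>y. y i"]) simp_all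
    then have "(\<lambda>x. x t i * x t j :: real) \<in> borel_measurable (\<Pi>\<^sub>M t \<in> {t}. (\<Pi>\<^sub>M i \<in> UNIV. borel))" for t :: nat
      by (intro borel_measurable_times)
    from indep_var_compose[OF indep_var_restrict[OF serial, of "{s}" "{t}"] this this] show ?thesis
      using assms by (simp add: o_def)
  qed
  show "integrable M (\<lambda>\<omega>. (v i s \<omega> * v i t \<omega>)\<^sup>2)" for i
    using indep_var_integrable[OF v2[of i i]] v_mult_integrable
    by (simp add: power2_eq_square mult_ac)
  fix n i :: nat assume i: "i < n"
  have "expectation (\<lambda>\<omega>. v i s \<omega> * v i t \<omega> * (v j s \<omega> * v j t \<omega>)) = \<sigma>v i j * \<sigma>v i j" for j
    using indep_var_lebesgue_integral[OF v2[of i j]] v_mult_integrable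
    by (simp add: second mult_ac)
  then have "(\<Sum>j<n. expectation (\<lambda>\<omega>. v i s \<omega> * v i t \<omega> * (v j s \<omega> * v j t \<omega>))) = (\<Sum>j<n. \<bar>\<sigma>v i j\<bar> * \<bar>\<sigma>v i j\<bar>)"
    by simp
  also have "\<dots> \<le> (\<Sum>j<n. C * \<bar>\<sigma>v i j\<bar>)"
    by (intro sum_mono mult_right_mono abs_cov_le) simp
  also have "\<dots> = C * (\<Sum>j<n. \<bar>\<sigma>v i j\<bar>)"
    by (simp add: sum_distrib_left)
  also have "\<dots> \<le> C * C"
    by (intro mult_left_mono row_sum i C_nonneg)
  finally show "(\<Sum>j<n. expectation (\<lambda>\<omega>. v i s \<omega> * v i t \<omega> * (v j s \<omega> * v j t \<omega>))) \<le> C * C" .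
qed measurable

lemma conv_in_prob_scov_weighted:
  assumes h[measurable]: "\<And>i. h i \<in> borel_measurable N"
    and sq: "\<And>i. integrable M (\<lambda>\<omega>. (h i (Z \<omega>))\<^sup>2)"
    and D: "\<And>i. expectation (\<lambda>\<omega>. (h i (Z \<omega>))\<^sup>2) \<le> D"
  shows "conv_in_prob M (\<lambda>n \<omega>. scov n (\<lambda>i. h i (Z \<omega>)) (\<lambda>i. v i t \<omega>)) (\<lambda>_. 0)"
  unfolding scov_centered_left
\<comment> \<open>Only the weights need centring. The constant 4 comes from
  \<open>(x - y)\<^sup>2 \<le> 2 * x\<^sup>2 + 2 * y\<^sup>2\<close>, where the squared mean is
  bounded by the mean square and hence also contributes \<open>2 * D\<close>.\<close>
proof (rule conv_in_prob_avg_v_weighted[where h="\<lambda>n i z. h i z - avg n (\<lambda>i. h i z)" and D="4 * D"])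
  fix n i
  have D0: "0 \<le> D"
    using order_trans[OF Bochner_Integration.integral_nonneg D[of i]] by simp
  have le: "(h i z - avg n (\<lambda>i. h i z))\<^sup>2 \<le> 2 * (h i z)\<^sup>2 + 2 * avg n (\<lambda>i. (h i z)\<^sup>2)" for z
  proof -
    have "(x - y)\<^sup>2 \<le> 2 * x\<^sup>2 + 2 * y\<^sup>2" for x y :: real
      using zero_le_power2[of "x + y"] by (simp add: power2_sum power2_diff)
    from this[of "h i z" "avg n (\<lambda>i. h i z)"] avg_power2_le[of n "\<lambda>i. h i z"] show ?thesis
      by simp
  qed
  have int: "integrable M (\<lambda>\<omega>. 2 * (h i (Z \<omega>))\<^sup>2 + 2 * avg n (\<lambda>i. (h i (Z \<omega>))\<^sup>2))"
    unfolding avg_def using sq by simp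
  show sq': "integrable M (\<lambda>\<omega>. (h i (Z \<omega>) - avg n (\<lambda>i. h i (Z \<omega>)))\<^sup>2)"
    by (rule Bochner_Integration.integrable_bound[OF int]) (use le in \<open>auto intro: order_trans[OF _ abs_ge_self]\<close>)
  have "expectation (\<lambda>\<omega>. (h i (Z \<omega>) - avg n (\<lambda>i. h i (Z \<omega>)))\<^sup>2)
      \<le> expectation (\<lambda>\<omega>. 2 * (h i (Z \<omega>))\<^sup>2 + 2 * avg n (\<lambda>i. (h i (Z \<omega>))\<^sup>2))"
    by (rule integral_mono[OF sq' int le])
  also have "\<dots> = 2 * expectation (\<lambda>\<omega>. (h i (Z \<omega>))\<^sup>2) + 2 * avg n (\<lambda>i. expectation (\<lambda>\<omega>. (h i (Z \<omega>))\<^sup>2))"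
    unfolding avg_def using sq by simp
  also have "avg n (\<lambda>i. expectation (\<lambda>\<omega>. (h i (Z \<omega>))\<^sup>2)) \<le> avg n (\<lambda>i. D)"
    unfolding avg_def by (intro scaleR_left_mono sum_mono D) simp
  also have "avg n (\<lambda>i. D) \<le> D"
    using D0 by (cases "n = 0") (simp_all add: avg_def)
  finally show "expectation (\<lambda>\<omega>. (h i (Z \<omega>) - avg n (\<lambda>i. h i (Z \<omega>)))\<^sup>2) \<le> 4 * D"
    using D[of i] by simp
qed measurable

text \<open>The cross term vanishes because the error has mean zero and is independent of
  \<open>Z\<close>. This relates the variance of the composite error to that of its idiosyncratic
  part.\<close>

lemma expectation_square_add:
  assumes h[measurable]: "h \<in> borel_measurable N" and sq: "integrable M (\<lambda>\<omega>. (h (Z \<omega>))\<^sup>2)"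
  shows "expectation (\<lambda>\<omega>. (h (Z \<omega>) + v i t \<omega>)\<^sup>2) = expectation (\<lambda>\<omega>. (h (Z \<omega>))\<^sup>2) + \<sigma>v i i"
proof -
  have int: "integrable M (\<lambda>\<omega>. h (Z \<omega>))"
    using integrable_mult_if_squares[of "\<lambda>\<omega>. h (Z \<omega>)" "\<lambda>_. 1"] sq by simp
  have zero: "expectation (\<lambda>\<omega>. v i t \<omega> * h (Z \<omega>)) = 0"
    using indep_var_lebesgue_integral[OF indep_Z_v[OF h]] v_integrable int by (simp add: mean)
  have "expectation (\<lambda>\<omega>. (h (Z \<omega>) + v i t \<omega>)\<^sup>2)
      = expectation (\<lambda>\<omega>. (h (Z \<omega>))\<^sup>2 + (v i t \<omega> * v i t \<omega> + 2 * (v i t \<omega> * h (Z \<omega>))))"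
    by (simp add: power2_eq_square algebra_simps)
  also have "\<dots> = expectation (\<lambda>\<omega>. (h (Z \<omega>))\<^sup>2) + \<sigma>v i i"
    using sq v_mult_integrable indep_var_integrable[OF indep_Z_v[OF h] v_integrable int]
    by (simp add: zero second)
  finally show ?thesis .
qed

end

section \<open>The bias of the Fama--MacBeth estimator\<close>

theorem theorem1:
  fixes M :: "'w measure"
    and f :: "nat \<Rightarrow> 'w \<Rightarrow> real ^ 'k" and \<beta> :: "nat \<Rightarrow> 'w \<Rightarrow> real ^ 'k"
    and g :: "nat \<Rightarrow> 'w \<Rightarrow> real"
    and \<gamma> \<eta> :: "nat \<Rightarrow> 'w \<Rightarrow> real"
    and a :: "nat \<Rightarrow> 'w \<Rightarrow> real"
    and v u r :: "nat \<Rightarrow> nat \<Rightarrow> 'w \<Rightarrow> real"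
    and c :: real and lam0 \<mu>0 \<phi>0 :: "real ^ 'k"
    and \<alpha> :: "'k \<Rightarrow> real" and \<alpha>\<gamma> \<alpha>\<eta> :: real
    and \<sigma>2 :: "nat \<Rightarrow> real" and \<sigma>bar2 :: real and \<Sigma>\<beta>\<beta> :: "real ^ 'k ^ 'k"
    and T0 T :: nat
  assumes "prob_space M"
    and returns: "\<And>i t \<omega>. r i t \<omega> = a i \<omega> + \<beta> i \<omega> \<bullet> f t \<omega> + u i t \<omega>"
    and errors: "\<And>i t \<omega>. u i t \<omega> = \<gamma> i \<omega> * g t \<omega> + v i t \<omega>"
    and alphas: "\<And>i \<omega>. a i \<omega> = c + \<beta> i \<omega> \<bullet> \<phi>0 + \<eta> i \<omega>"
    and "\<phi>0 = lam0 - \<mu>0"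
    and "assumption1 M f \<mu>0 T0"
    and "assumption2 M \<beta> \<alpha>"
    and "assumption3 M f g \<gamma> \<alpha>\<gamma>"
    and "assumption4 M f g \<beta> \<gamma> v"
    and "assumption5 M \<beta> \<gamma> \<eta> \<alpha>\<eta>"
    and strong: "\<And>k. \<alpha> k = 1"
    and "\<alpha>\<gamma> < 1 / 2"
    and "\<And>i t. \<sigma>2 i = (LINT \<omega>|M. (u i t \<omega>)\<^sup>2)"
    and "(\<lambda>n. avg n \<sigma>2) \<longlonglongrightarrow> \<sigma>bar2" and "\<sigma>bar2 > 0"
    and "conv_in_prob M (\<lambda>n \<omega>. (1 / real n) *\<^sub>R gram n (\<lambda>i. \<beta> i \<omega>)) (\<lambda>_. \<Sigma>\<beta>\<beta>)"
    and "T > T0"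
    and "AE \<omega> in M. 0 < lambda_min ((1 / real T) *\<^sub>R gram T (\<lambda>t. f t \<omega>))"
  shows "conv_in_prob M
    (\<lambda>n \<omega>.
       let \<mu>T = avg T (\<lambda>t. f t \<omega>);
           lamT = lam0 + (\<mu>T - \<mu>0);
           Sinv = matrix_inv ((1 / real T) *\<^sub>R gram T (\<lambda>t. f t \<omega>))
       in (lambda_hat n T (\<lambda>t. f t \<omega>) (\<lambda>i t. r i t \<omega>) - lam0)
          - ((\<mu>T - \<mu>0)
             - (\<sigma>bar2 / real T) *\<^sub>R
                 (matrix_inv (\<Sigma>\<beta>\<beta> + (\<sigma>bar2 / real T) *\<^sub>R Sinv) *v (Sinv *v lamT))))
    (\<lambda>_. 0)"
proof -

  \<comment> \<open>Idiosyncratic errors and measurability of the model\<close>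
  interpret prob_space M by fact
  let ?N = "(\<Pi>\<^sub>M t \<in> UNIV. borel) \<Otimes>\<^sub>M (\<Pi>\<^sub>M t \<in> UNIV. borel) \<Otimes>\<^sub>M
    (\<Pi>\<^sub>M i \<in> UNIV. borel) \<Otimes>\<^sub>M (\<Pi>\<^sub>M i \<in> UNIV. borel) ::
    ((nat \<Rightarrow> real ^ 'k) \<times> (nat \<Rightarrow> real) \<times> (nat \<Rightarrow> real ^ 'k) \<times> (nat \<Rightarrow> real)) measure"
  let ?Z = "\<lambda>\<omega>. (\<lambda>t. f t \<omega>, \<lambda>t. g t \<omega>, \<lambda>i. \<beta> i \<omega>, \<lambda>i. \<gamma> i \<omega>)"
  have "\<exists>\<sigma>v C. idiosyncratic_errors M v \<sigma>v C ?N ?Z"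
  proof -
    from \<open>assumption4 M f g \<beta> \<gamma> v\<close> obtain \<sigma>v C where
      "indep_rv M (\<Pi>\<^sub>M (i, t) \<in> UNIV. borel) (\<lambda>\<omega> (i, t). v i t \<omega>) ?N ?Z"
      "indep_vars (\<lambda>_. \<Pi>\<^sub>M i \<in> UNIV. borel) (\<lambda>t \<omega> i. v i t \<omega>) UNIV"
      "\<forall>i t. (LINT \<omega>|M. v i t \<omega>) = 0 \<and> integrable M (\<lambda>\<omega>. v i t \<omega> ^ 4)"
      "\<forall>i j t. (LINT \<omega>|M. v i t \<omega> * v j t \<omega>) = \<sigma>v i j"
      "\<forall>n. \<forall>i<n. (\<Sum>j<n. \<bar>\<sigma>v i j\<bar>) \<le> C"
      "\<forall>t. \<exists>C. \<forall>n. \<forall>i<n. (\<Sum>j<n. cov M (\<lambda>\<omega>. (v i t \<omega>)\<^sup>2) (\<lambda>\<omega>. (v j t \<omega>)\<^sup>2)) \<le> C"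
      unfolding assumption4_def by (elim exE conjE) (rule that; assumption)
    then have "idiosyncratic_errors M v \<sigma>v C ?N ?Z"
      by unfold_locales (simp_all add: case_prod_unfold)
    then show ?thesis
      by blast
  qed
  then obtain \<sigma>v C where "idiosyncratic_errors M v \<sigma>v C ?N ?Z"
    by blast
  then interpret idiosyncratic_errors M v \<sigma>v C ?N ?Z .

  \<comment> \<open>Measurability of factors and loadings is read off from that of the joint element
    \<open>?Z\<close>.\<close>
  have f_comp: "(\<lambda>z. fst z t) \<in> borel_measurable ?N" for t
    by simp
  have g_comp: "(\<lambda>z. fst (snd z) t) \<in> borel_measurable ?N" for t
    by simp
  have \<beta>_comp: "(\<lambda>z. fst (snd (snd z)) i) \<in> borel_measurable ?N" for i
    by simp
  have \<gamma>_comp: "(\<lambda>z. snd (snd (snd z)) i) \<in> borel_measurable ?N" for i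
    by simp
  have [measurable]: "f t \<in> borel_measurable M" "g t \<in> borel_measurable M" "\<beta> i \<in> borel_measurable M" "\<gamma> i \<in> borel_measurable M" for t i
    using measurable_compose[OF Z_measurable f_comp[of t]] measurable_compose[OF Z_measurable g_comp[of t]]
      measurable_compose[OF Z_measurable \<beta>_comp[of i]] measurable_compose[OF Z_measurable \<gamma>_comp[of i]]
    by simp_all
  have [measurable]: "\<eta> i \<in> borel_measurable M" for i
  proof -
    have "(\<lambda>\<omega> i. \<eta> i \<omega>) \<in> measurable M (\<Pi>\<^sub>M i \<in> UNIV. borel)"
      using \<open>assumption5 M \<beta> \<gamma> \<eta> \<alpha>\<eta>\<close> by (simp add: assumption5_def indep_rv_def)
    from measurable_compose[OF this measurable_component_singleton[of i]] show ?thesis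
      by simp
  qed
  have [measurable]: "r i t \<in> borel_measurable M" for i t
  proof -
    have "r i t = (\<lambda>\<omega>. c + \<beta> i \<omega> \<bullet> \<phi>0 + \<eta> i \<omega> + \<beta> i \<omega> \<bullet> f t \<omega> + (\<gamma> i \<omega> * g t \<omega> + v i t \<omega>))"
      by (simp add: fun_eq_iff returns errors alphas)
    then show ?thesis
      by simp
  qed

  \<comment> \<open>Covariances of loadings with errors, and the sparse components\<close>
  obtain D where \<beta>_sq: "\<And>i k. integrable M (\<lambda>\<omega>. (\<beta> i \<omega> $ k)\<^sup>2)"
    and D: "\<And>i k. expectation (\<lambda>\<omega>. (\<beta> i \<omega> $ k)\<^sup>2) < D"
    using \<open>assumption2 M \<beta> \<alpha>\<close> unfolding assumption2_def by blast
  have \<beta>v: "conv_in_prob M (\<lambda>n \<omega>. scov n (\<lambda>i. \<beta> i \<omega> $ k) (\<lambda>i. v i t \<omega>)) (\<lambda>_. 0)" for k t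
    using conv_in_prob_scov_weighted[of "\<lambda>i z. fst (snd (snd z)) i $ k" D t] \<beta>_sq D \<beta>_comp
    by (simp add: less_imp_le borel_measurable_vec_nth)

  obtain C\<gamma> where C\<gamma>: "AE \<omega> in M. \<forall>i. \<bar>\<gamma> i \<omega>\<bar> < C\<gamma>"
    using \<open>assumption3 M f g \<gamma> \<alpha>\<gamma>\<close> unfolding assumption3_def by blast
  have \<gamma>0: "AE \<omega> in M. (\<lambda>n. avg n (\<lambda>i. (\<gamma> i \<omega>)\<^sup>2)) \<longlonglongrightarrow> 0"
  proof -
    have "AE \<omega> in M. (\<lambda>n. \<Sum>i<n. \<bar>\<gamma> i \<omega>\<bar>) \<in> O(\<lambda>n. real n powr \<alpha>\<gamma>)"
      using \<open>assumption3 M f g \<gamma> \<alpha>\<gamma>\<close> unfolding assumption3_def by blast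
    with C\<gamma> show ?thesis
      by eventually_elim (use \<open>\<alpha>\<gamma> < 1 / 2\<close> in \<open>auto intro: avg_square_tendsto_zero_if_sparse\<close>)
  qed
  have \<eta>0: "AE \<omega> in M. (\<lambda>n. avg n (\<lambda>i. (\<eta> i \<omega>)\<^sup>2)) \<longlonglongrightarrow> 0"
  proof -
    obtain C\<eta> where "AE \<omega> in M. \<forall>i. \<bar>\<eta> i \<omega>\<bar> < C\<eta>"
      and "AE \<omega> in M. (\<lambda>n. \<Sum>i<n. \<bar>\<eta> i \<omega>\<bar>) \<in> O(\<lambda>n. real n powr \<alpha>\<eta>)" and \<alpha>\<eta>: "\<alpha>\<eta> < 1 / 2"
      using \<open>assumption5 M \<beta> \<gamma> \<eta> \<alpha>\<eta>\<close> unfolding assumption5_def by blast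
    from this(1,2) show ?thesis
      by eventually_elim (use \<alpha>\<eta> in \<open>auto intro: avg_square_tendsto_zero_if_sparse\<close>)
  qed

  \<comment> \<open>The limit of the mean idiosyncratic variance\<close>
  have \<sigma>_lim: "(\<lambda>n. avg n (\<lambda>i. \<sigma>v i i)) \<longlonglongrightarrow> \<sigma>bar2"
  proof -
    have g4: "integrable M (\<lambda>\<omega>. g 0 \<omega> ^ 4)"
      using \<open>assumption3 M f g \<gamma> \<alpha>\<gamma>\<close> unfolding assumption3_def by blast
    have g2: "integrable M (\<lambda>\<omega>. (g 0 \<omega>)\<^sup>2)"
      using integrable_mult_if_squares[of "\<lambda>\<omega>. (g 0 \<omega>)\<^sup>2" "\<lambda>_. 1"] g4 by (simp add: power_mult[symmetric])
    have sq: "integrable M (\<lambda>\<omega>. (\<gamma> i \<omega> * g 0 \<omega>)\<^sup>2)" for i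
    proof (rule Bochner_Integration.integrable_bound)
      show "integrable M (\<lambda>\<omega>. C\<gamma>\<^sup>2 * (g 0 \<omega>)\<^sup>2)"
        using g2 by simp
      show "AE \<omega> in M. norm ((\<gamma> i \<omega> * g 0 \<omega>)\<^sup>2) \<le> norm (C\<gamma>\<^sup>2 * (g 0 \<omega>)\<^sup>2)"
        using C\<gamma>
      proof eventually_elim
        case (elim \<omega>)
        then have "(\<gamma> i \<omega>)\<^sup>2 \<le> C\<gamma>\<^sup>2"
          by (intro iffD1[OF abs_le_square_iff]) (auto intro: less_imp_le order.trans[OF _ abs_ge_self])
        then show ?case
          by (simp add: power_mult_distrib mult_right_mono)
      qed
    qed simp
    \<comment> \<open>The variance \<open>\<sigma>2 i\<close> is common to all periods, so period 0
      serves to split off the contribution of the missing factor.\<close>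
    have \<sigma>2: "\<sigma>2 i = expectation (\<lambda>\<omega>. (\<gamma> i \<omega> * g 0 \<omega>)\<^sup>2) + \<sigma>v i i" for i
    proof -
      have [measurable]: "(\<lambda>z. snd (snd (snd z)) i * fst (snd z) 0) \<in> borel_measurable ?N"
        using \<gamma>_comp g_comp by (intro borel_measurable_times)
      show ?thesis
        using expectation_square_add[of "\<lambda>z. snd (snd (snd z)) i * fst (snd z) 0" i 0] sq
        by (simp add: \<open>\<And>i t. \<sigma>2 i = (LINT \<omega>|M. (u i t \<omega>)\<^sup>2)\<close>[of i 0] errors)
    qed
    \<comment> \<open>The loadings \<gamma> are random, so the limit is taken on each path and then
      carried through the expectation; their uniform bound yields an integrable envelope.\<close>
    have "(\<lambda>n. expectation (\<lambda>\<omega>. avg n (\<lambda>i. (\<gamma> i \<omega> * g 0 \<omega>)\<^sup>2))) \<longlonglongrightarrow> expectation (\<lambda>\<omega>. 0)"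
    proof (rule integral_dominated_convergence[where w="\<lambda>\<omega>. C\<gamma>\<^sup>2 * (g 0 \<omega>)\<^sup>2"])
      have eq: "avg n (\<lambda>i. (\<gamma> i \<omega> * g 0 \<omega>)\<^sup>2) = avg n (\<lambda>i. (\<gamma> i \<omega>)\<^sup>2) * (g 0 \<omega>)\<^sup>2" for n \<omega>
        by (simp add: avg_def power_mult_distrib sum_distrib_right)
      show "AE \<omega> in M. (\<lambda>n. avg n (\<lambda>i. (\<gamma> i \<omega> * g 0 \<omega>)\<^sup>2)) \<longlonglongrightarrow> 0"
        using \<gamma>0 unfolding eq by eventually_elim (rule tendsto_mult_left_zero)
      show "AE \<omega> in M. norm (avg n (\<lambda>i. (\<gamma> i \<omega> * g 0 \<omega>)\<^sup>2)) \<le> C\<gamma>\<^sup>2 * (g 0 \<omega>)\<^sup>2" for n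
        using C\<gamma>
      proof eventually_elim
        case (elim \<omega>)
        have "(\<gamma> i \<omega>)\<^sup>2 \<le> C\<gamma>\<^sup>2" for i
          using elim by (intro iffD1[OF abs_le_square_iff]) (auto intro: less_imp_le order.trans[OF _ abs_ge_self])
        then have "avg n (\<lambda>i. (\<gamma> i \<omega>)\<^sup>2) \<le> avg n (\<lambda>i. C\<gamma>\<^sup>2)"
          unfolding avg_def by (intro scaleR_left_mono sum_mono) auto
        also have "\<dots> \<le> C\<gamma>\<^sup>2"
          by (cases "n = 0") (simp_all add: avg_def)
        finally have "avg n (\<lambda>i. (\<gamma> i \<omega>)\<^sup>2) \<le> C\<gamma>\<^sup>2" .
        moreover have "0 \<le> avg n (\<lambda>i. (\<gamma> i \<omega>)\<^sup>2)"
          by (simp add: avg_def sum_nonneg)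
        ultimately show ?case
          unfolding eq by (simp add: abs_mult mult_right_mono)
      qed
    qed (use g2 in auto)
    moreover have "expectation (\<lambda>\<omega>. avg n (\<lambda>i. (\<gamma> i \<omega> * g 0 \<omega>)\<^sup>2)) = avg n \<sigma>2 - avg n (\<lambda>i. \<sigma>v i i)" for n
      unfolding avg_def \<sigma>2 using sq by (simp add: sum.distrib add_divide_distrib)
    ultimately have "(\<lambda>n. avg n \<sigma>2 - avg n (\<lambda>i. \<sigma>v i i)) \<longlonglongrightarrow> 0"
      by simp
    from tendsto_diff[OF \<open>(\<lambda>n. avg n \<sigma>2) \<longlonglongrightarrow> \<sigma>bar2\<close> this] show ?thesis
      by simp
  qed

  have T: "0 < T"
    using \<open>T > T0\<close> by simp
  have pd: "AE \<omega> in M. pos_def ((1 / real T) *\<^sub>R gram T (\<lambda>t. f t \<omega>))"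
  proof -
    have "AE \<omega> in M. \<exists>C>0. \<forall>T>T0. full_column_rank T (\<lambda>t. f t \<omega>) \<and>
        pos_def ((1 / real T) *\<^sub>R gram T (\<lambda>t. f t \<omega>)) \<and>
        lambda_max (matrix_inv ((1 / real T) *\<^sub>R gram T (\<lambda>t. f t \<omega>))) < C"
      using \<open>assumption1 M f \<mu>0 T0\<close> unfolding assumption1_def by blast
    then show ?thesis
      by eventually_elim (use \<open>T > T0\<close> in blast)
  qed

  \<comment> \<open>Finitely many sequences converging in probability\<close>
  define G where "G = (\<lambda>n \<omega>. norm ((1 / real n) *\<^sub>R gram n (\<lambda>i. \<beta> i \<omega>) - \<Sigma>\<beta>\<beta>))"
  define BV where "BV k t = (\<lambda>n \<omega>. scov n (\<lambda>i. \<beta> i \<omega> $ k) (\<lambda>i. v i t \<omega>))" for k t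
  define V where "V t = (\<lambda>n \<omega>. avg n (\<lambda>i. v i t \<omega>))" for t
  define VV where "VV s t = (\<lambda>n \<omega>. avg n (\<lambda>i. v i s \<omega> * v i t \<omega> - (if s = t then \<sigma>v i i else 0)))" for s t
  \<comment> \<open>Taking the norm in \<open>G\<close> and centring the diagonal of
    \<open>VV\<close> make every member a real sequence with limit 0. The set is finite because
    \<open>T\<close> is fixed and the factors are indexed by a finite type.\<close>
  define S where "S = {G} \<union> (\<Union>k. BV k ` {..<T}) \<union> V ` {..<T} \<union> (\<Union>s<T. VV s ` {..<T})"
  have S_fin: "finite S"
    by (simp add: S_def)
  have "conv_in_prob M G (\<lambda>_. 0)"
    using \<open>conv_in_prob M (\<lambda>n \<omega>. (1 / real n) *\<^sub>R gram n (\<lambda>i. \<beta> i \<omega>)) (\<lambda>_. \<Sigma>\<beta>\<beta>)\<close>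
    by (simp add: conv_in_prob_def G_def dist_norm)
  moreover have "conv_in_prob M (VV s t) (\<lambda>_. 0)" for s t
    using conv_in_prob_avg_v_square[of t] conv_in_prob_avg_v_cross[of s t] by (cases "s = t") (simp_all add: VV_def power2_eq_square)
  ultimately have S_conv: "conv_in_prob M X (\<lambda>_. 0)" if "X \<in> S" for X
    using that \<beta>v conv_in_prob_avg_v by (auto simp: S_def BV_def V_def)

  \<comment> \<open>The limit along a subsequence on a fixed path\<close>
  show ?thesis
  proof (rule conv_in_prob_subseqI[OF S_fin S_conv], goal_cases)
    case 1
    then show ?case .
  next
    case (2 n)
    show ?case
      unfolding Let_def by measurable
  next
    case 3
    from \<gamma>0 \<eta>0 pd show ?case
    proof eventually_elim
      case (elim \<omega>)
      show ?case
      proof (intro allI impI)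
        fix q :: "nat \<Rightarrow> nat" assume q: "strict_mono q" and lim: "\<forall>X\<in>S. (\<lambda>n. X (q n) \<omega>) \<longlonglongrightarrow> 0"
        have q_top: "filterlim q sequentially sequentially"
          using q by (rule filterlim_subseq)
        \<comment> \<open>The subsequence is encoded in the filter, so all statistics keep their
          index \<open>n\<close> and \<open>fama_macbeth_limit\<close> applies directly.\<close>
        let ?Fl = "filtermap q sequentially"
        have Fl_le: "?Fl \<le> sequentially"
          using q_top by (simp add: filterlim_def)
        have along: "(X \<longlongrightarrow> L) ?Fl" if "X \<longlonglongrightarrow> L" for X :: "nat \<Rightarrow> real" and L
          using that Fl_le by (rule tendsto_mono[rotated])
        have SX: "((\<lambda>n. X n \<omega>) \<longlongrightarrow> 0) ?Fl" if "X \<in> S" for X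
          using that lim by (simp add: filterlim_filtermap)
        have G: "((\<lambda>n. (1 / real n) *\<^sub>R gram n (\<lambda>i. \<beta> i \<omega>)) \<longlongrightarrow> \<Sigma>\<beta>\<beta>) ?Fl"
          using SX[of G] by (simp add: S_def G_def LIM_zero_iff tendsto_norm_zero_iff)
        have n_pos: "\<forall>\<^sub>F n in ?Fl. 0 < n"
          using Fl_le eventually_gt_at_top[of "0::nat"] by (rule filter_leD)
        have BB: "((\<lambda>n. scov n (\<lambda>i. \<beta> i \<omega> $ k) (\<lambda>i. \<beta> i \<omega> $ l)) \<longlongrightarrow> \<Sigma>\<beta>\<beta> $ k $ l) ?Fl" for k l
        proof (rule Lim_transform_eventually)
          show "((\<lambda>n. ((1 / real n) *\<^sub>R gram n (\<lambda>i. \<beta> i \<omega>)) $ k $ l) \<longlongrightarrow> \<Sigma>\<beta>\<beta> $ k $ l) ?Fl"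
            by (intro tendsto_intros G)
          show "\<forall>\<^sub>F n in ?Fl. ((1 / real n) *\<^sub>R gram n (\<lambda>i. \<beta> i \<omega>)) $ k $ l
              = scov n (\<lambda>i. \<beta> i \<omega> $ k) (\<lambda>i. \<beta> i \<omega> $ l)"
            using n_pos by eventually_elim (simp add: gram_nth)
        qed
        have null: "((\<lambda>n. scov n x x) \<longlongrightarrow> 0) ?Fl" if "(\<lambda>n. avg n (\<lambda>i. (x i)\<^sup>2)) \<longlonglongrightarrow> 0" for x
          by (rule tendsto_sandwich[OF _ _ tendsto_const along[OF that]])
             (auto intro!: always_eventually scov_self_nonneg scov_self_le)
        have \<gamma>\<gamma>: "((\<lambda>n. scov n (\<lambda>i. \<gamma> i \<omega>) (\<lambda>i. \<gamma> i \<omega>)) \<longlongrightarrow> 0) ?Fl"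
          using elim(1) by (rule null)
        have vv: "((\<lambda>n. scov n (\<lambda>i. v i s \<omega>) (\<lambda>i. v i t \<omega>)) \<longlongrightarrow> (if s = t then \<sigma>bar2 else 0)) ?Fl"
          if "s < T" "t < T" for s t
        proof -
          \<comment> \<open>The covariance is the centred second moment, plus its centre when
            \<open>s = t\<close>, minus the product of two vanishing means.\<close>
          have "((\<lambda>n. VV s t n \<omega> + (if s = t then avg n (\<lambda>i. \<sigma>v i i) else 0) - V s n \<omega> * V t n \<omega>)
              \<longlongrightarrow> 0 + (if s = t then \<sigma>bar2 else 0) - 0 * 0) ?Fl"
            using that along[OF \<sigma>_lim] by (intro tendsto_intros SX) (auto simp: S_def)
          moreover have "VV s t n \<omega> + (if s = t then avg n (\<lambda>i. \<sigma>v i i) else 0) - V s n \<omega> * V t n \<omega>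
              = scov n (\<lambda>i. v i s \<omega>) (\<lambda>i. v i t \<omega>)" for n
            by (simp add: VV_def V_def scov_def avg_def sum_subtractf diff_divide_distrib)
          ultimately show ?thesis
            by simp
        qed
        have \<gamma>v: "((\<lambda>n. scov n (\<lambda>i. \<gamma> i \<omega>) (\<lambda>i. v i t \<omega>)) \<longlongrightarrow> 0) ?Fl"
          and v\<gamma>: "((\<lambda>n. scov n (\<lambda>i. v i t \<omega>) (\<lambda>i. \<gamma> i \<omega>)) \<longlongrightarrow> 0) ?Fl" if "t < T" for t
          using tendsto_scov_null[OF \<gamma>\<gamma> vv[OF that that]] by (simp_all add: scov_commute)
        \<comment> \<open>On a fixed path \<open>g s \<omega>\<close> and
          \<open>g t \<omega>\<close> are scalars, so bilinearity expands \<open>u\<close> into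
          \<gamma> and \<open>v\<close>; only the covariance of \<open>v\<close> with itself
          survives.\<close>
        have UU: "((\<lambda>n. scov n (\<lambda>i. u i s \<omega>) (\<lambda>i. u i t \<omega>)) \<longlongrightarrow> (if s = t then \<sigma>bar2 else 0)) ?Fl"
          if "s < T" "t < T" for s t
        proof -
          have "((\<lambda>n. g s \<omega> * (g t \<omega> * scov n (\<lambda>i. \<gamma> i \<omega>) (\<lambda>i. \<gamma> i \<omega>)) + g s \<omega> * scov n (\<lambda>i. \<gamma> i \<omega>) (\<lambda>i. v i t \<omega>)
              + (g t \<omega> * scov n (\<lambda>i. v i s \<omega>) (\<lambda>i. \<gamma> i \<omega>) + scov n (\<lambda>i. v i s \<omega>) (\<lambda>i. v i t \<omega>)))
              \<longlongrightarrow> g s \<omega> * (g t \<omega> * 0) + g s \<omega> * 0 + (g t \<omega> * 0 + (if s = t then \<sigma>bar2 else 0))) ?Fl"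
            using that by (intro tendsto_intros \<gamma>\<gamma> \<gamma>v v\<gamma> vv)
          moreover have "scov n (\<lambda>i. u i s \<omega>) (\<lambda>i. u i t \<omega>)
              = g s \<omega> * (g t \<omega> * scov n (\<lambda>i. \<gamma> i \<omega>) (\<lambda>i. \<gamma> i \<omega>)) + g s \<omega> * scov n (\<lambda>i. \<gamma> i \<omega>) (\<lambda>i. v i t \<omega>)
              + (g t \<omega> * scov n (\<lambda>i. v i s \<omega>) (\<lambda>i. \<gamma> i \<omega>) + scov n (\<lambda>i. v i s \<omega>) (\<lambda>i. v i t \<omega>))" for n
            by (simp add: errors mult.commute[of "\<gamma> _ \<omega>"] scov_add_left scov_add_right scov_cmult_left scov_cmult_right
                distrib_left)
          ultimately show ?thesis
            by simp
        qed
        have BU: "((\<lambda>n. scov n (\<lambda>i. \<beta> i \<omega> $ k) (\<lambda>i. u i t \<omega>)) \<longlongrightarrow> 0) ?Fl" if "t < T" for k t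
        proof -
          have "((\<lambda>n. g t \<omega> * scov n (\<lambda>i. \<gamma> i \<omega>) (\<lambda>i. \<beta> i \<omega> $ k) + BV k t n \<omega>) \<longlongrightarrow> g t \<omega> * 0 + 0) ?Fl"
            using that by (intro tendsto_intros SX tendsto_scov_null[OF \<gamma>\<gamma> BB]) (auto simp: S_def)
          then show ?thesis
            by (simp add: BV_def errors mult.commute[of "\<gamma> _ \<omega>"] scov_add_right scov_cmult_right
                scov_commute[of _ "\<lambda>i. \<gamma> i \<omega>"])
        qed
        have "((\<lambda>n. lambda_hat n T (\<lambda>t. f t \<omega>) (\<lambda>i t. r i t \<omega>)) \<longlongrightarrow>
            (\<phi>0 + avg T (\<lambda>t. f t \<omega>)) - (\<sigma>bar2 / real T) *\<^sub>R
              (matrix_inv (\<Sigma>\<beta>\<beta> + (\<sigma>bar2 / real T) *\<^sub>R matrix_inv ((1 / real T) *\<^sub>R gram T (\<lambda>t. f t \<omega>))) *v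
                (matrix_inv ((1 / real T) *\<^sub>R gram T (\<lambda>t. f t \<omega>)) *v (\<phi>0 + avg T (\<lambda>t. f t \<omega>))))) ?Fl"
          using elim(3) \<open>\<sigma>bar2 > 0\<close> BB BU UU null[OF elim(2)]
          by (intro fama_macbeth_limit[where U="\<lambda>i t. u i t \<omega>" and e="\<lambda>i. \<eta> i \<omega>" and B="\<lambda>i. \<beta> i \<omega>" and c=c])
             (auto simp: Fl_le T returns alphas filtermap_bot_iff)
        then have "(\<lambda>n. lambda_hat (q n) T (\<lambda>t. f t \<omega>) (\<lambda>i t. r i t \<omega>)) \<longlonglongrightarrow>
            (\<phi>0 + avg T (\<lambda>t. f t \<omega>)) - (\<sigma>bar2 / real T) *\<^sub>R
              (matrix_inv (\<Sigma>\<beta>\<beta> + (\<sigma>bar2 / real T) *\<^sub>R matrix_inv ((1 / real T) *\<^sub>R gram T (\<lambda>t. f t \<omega>))) *v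
                (matrix_inv ((1 / real T) *\<^sub>R gram T (\<lambda>t. f t \<omega>)) *v (\<phi>0 + avg T (\<lambda>t. f t \<omega>))))"
          by (simp add: filterlim_filtermap)
        \<comment> \<open>Since \<open>\<phi>0 = lam0 - \<mu>0\<close>, the vector
          \<open>\<phi>0 + avg T (\<lambda>t. f t \<omega>)\<close> is \<open>lamT\<close>;
          subtracting \<open>lam0\<close> leaves the deviation of the factor mean.\<close>
        from LIM_zero[OF this] show "(\<lambda>n.
            let \<mu>T = avg T (\<lambda>t. f t \<omega>);
                lamT = lam0 + (\<mu>T - \<mu>0);
                Sinv = matrix_inv ((1 / real T) *\<^sub>R gram T (\<lambda>t. f t \<omega>))
            in (lambda_hat (q n) T (\<lambda>t. f t \<omega>) (\<lambda>i t. r i t \<omega>) - lam0)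
              - ((\<mu>T - \<mu>0)
                 - (\<sigma>bar2 / real T) *\<^sub>R
                     (matrix_inv (\<Sigma>\<beta>\<beta> + (\<sigma>bar2 / real T) *\<^sub>R Sinv) *v (Sinv *v lamT)))) \<longlonglongrightarrow> 0"
          by (simp add: Let_def \<open>\<phi>0 = lam0 - \<mu>0\<close> algebra_simps)
      qed
    qed
  qed
qed

end
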